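(* Let $u$ be an optimal solution of $\min_{v\in\mathcal U^{\mathrm{ad}}}j(v)$, let $\{u^n\}$ be generated by the projected stochastic gradient method described in the context, and let iterates be averaged according to $$\tilde u_i^N=\sum_{n=i}^N\gamma_nu^n,\qquad\gamma_n=\frac{t_n}{\sum_{\ell=i}^Nt_\ell}.$$ Suppose $j$ is convex. (1) With the constant step size policy $t_n=t=\frac{D_{\mathrm{ad}}}{\sqrt{MN}}$ ($n=1,\dots,N$) and bias $K_n$ satisfying $\sum_{n=1}^NK_n\propto\sqrt N$, $$\mathbb E[j(\tilde u_1^N)-j(u)]\le\mathcal O\Bigl(\frac1{\sqrt N}\Bigr).$$ (2) If variable step sizes are chosen as $t_n=\frac{\theta D_{\mathrm{ad}}}{\sqrt{Mn}}$ for a constant $\theta>0$, and the bias satisfies $\sum_{n=i}^N\frac{K_n}{\sqrt n}\propto1$ for $i=\lceil\alpha N\rceil$ and some $\alpha\in(0,1)$, then $$\mathbb E[j(\tilde u_i^N)-j(u)]\le\mathcal O\Bigl(\frac1{\sqrt N}\Bigr).$$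
   Context: $(\mathcal U,(\cdot,\cdot)_{\mathcal U})$ is a Hilbert space with norm $\|\cdot\|_{\mathcal U}$, $\mathcal U^{\mathrm{ad}}\subset\mathcal U$ is nonempty, closed, convex and bounded, $(\Omega,\mathcal F,\mathbb P)$ is a probability space, and $\xi:\Omega\to\Xi\subset\mathbb R^m$ is a random vector. $J:\mathcal U\times\Xi\to\mathbb R$ is such that $v\mapsto J(v,\xi(\omega))$ is convex on $\mathcal U^{\mathrm{ad}}$ for almost every $\omega$, and $J$ is $L^2$-Fréchet differentiable on an open neighborhood of $\mathcal U^{\mathrm{ad}}$ (at each point $v$ the Fréchet derivative, a bounded linear random operator, is taken with the remainder measured in the $L^2(\Omega)$-norm). Set $j(v)=\mathbb E[J(v,\xi)]$; then $j$ is Fréchet differentiable with gradient $\nabla j$. Projected stochastic gradient method: given $u^1\in\mathcal U^{\mathrm{ad}}$ and $G:\mathcal U\times\Xi\to\mathcal U$ (the stochastic gradient), for $n=1,2,\dots$ generate a sample $\xi^n$ of $\xi$ independent of $\xi^1,\dots,\xi^{n-1}$, choose $t_n>0$, and set $u^{n+1}=\pi_{\mathcal U^{\mathrm{ad}}}(u^n-t_nG(u^n,\xi^n))$, where $\pi_{\mathcal U^{\mathrm{ad}}}$ is the metric projection onto $\mathcal U^{\mathrm{ad}}$. Assumption on the stochastic gradient: $\{\mathcal F_n\}$ is an increasing sequence of sub-$\sigma$-algebras of $\mathcal F$, and with $r^n=\mathbb E[G(u^n,\xi^n)\mid\mathcal F_n]-\nabla j(u^n)$ and $w^n=G(u^n,\xi^n)-\mathbb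 E[G(u^n,\xi^n)\mid\mathcal F_n]$: (i) $u^n$ and $r^n$ are $\mathcal F_n$-measurable; (ii) the bias $K_n:=\operatorname{ess\,sup}_{\omega\in\Omega}\|r^n(\omega)\|_{\mathcal U}$ satisfies $\sup_nK_n<\infty$; (iii) there is a constant $M>0$ with $\mathbb E[\|G(v,\xi)\|_{\mathcal U}^2]\le M$ for all $v\in\mathcal U^{\mathrm{ad}}$. $D_{\mathrm{ad}}:=\sup_{v\in\mathcal U^{\mathrm{ad}}}\|u^1-v\|_{\mathcal U}$ (positive, since step sizes are positive). In (1), for each $N$ the method is run for $N$ iterations with the step depending on $N$. The notation $A_N\propto B_N$ is used in the sense that $A_N$ is bounded by a constant, independent of $N$, times $B_N$; the constants in $\mathcal O$ are independent of $N$. *)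

theory Defs
  imports "HOL-Probability.Probability"
begin

text \<open>
  The Hilbert space is a type of class \<open>{real_inner, complete_space}\<close> and is \<^emph>\<open>not\<close> assumed to be
  separable. The library's Bochner integral, Borel measurability arithmetic and conditional
  expectation need \<open>second_countable_topology\<close> (or real values), so the vector-valued notions are
  given here in their standard form for arbitrary normed spaces.
\<close>

definition strongly_measurable :: "'w measure \<Rightarrow> ('w \<Rightarrow> 'b::topological_space) \<Rightarrow> bool" where
  "strongly_measurable M f \<longleftrightarrow>
     (\<exists>s. (\<forall>i. simple_function M (s i)) \<and> (\<forall>\<omega>\<in>space M. (\<lambda>i. s i \<omega>) \<longlonglongrightarrow> f \<omega>))"

lemma strongly_measurable_iff_borel_measurable:
  fixes f :: "'w \<Rightarrow> 'b::{metric_space, second_countable_topology}"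
  shows "strongly_measurable M f \<longleftrightarrow> f \<in> borel_measurable M"
proof
  assume "strongly_measurable M f"
  then obtain s where s: "\<And>i. simple_function M (s i)"
    "\<And>\<omega>. \<omega> \<in> space M \<Longrightarrow> (\<lambda>i. s i \<omega>) \<longlonglongrightarrow> f \<omega>"
    unfolding strongly_measurable_def by blast
  show "f \<in> borel_measurable M"
    by (rule borel_measurable_LIMSEQ_metric[OF borel_measurable_simple_function[OF s(1)] s(2)])
next
  assume "f \<in> borel_measurable M"
  from borel_measurable_implies_sequence_metric[OF this, of undefined]
  show "strongly_measurable M f"
    unfolding strongly_measurable_def by blast
qed

text \<open>This is \<^const>\<open>has_bochner_integral\<close> with strong in place of Borel measurability.\<close>

definition has_strong_integral ::
    "'w measure \<Rightarrow> ('w \<Rightarrow> 'b::real_normed_vector) \<Rightarrow> 'b \<Rightarrow> bool" where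
  "has_strong_integral M f I \<longleftrightarrow>
     strongly_measurable M f \<and>
     (\<exists>s. (\<forall>i. Bochner_Integration.simple_bochner_integrable M (s i)) \<and>
          (\<lambda>i. \<integral>\<^sup>+\<omega>. ennreal (norm (f \<omega> - s i \<omega>)) \<partial>M) \<longlonglongrightarrow> 0 \<and>
          (\<lambda>i. Bochner_Integration.simple_bochner_integral M (s i)) \<longlonglongrightarrow> I)"

lemma has_strong_integral_iff_has_bochner_integral:
  fixes f :: "'w \<Rightarrow> 'b::{real_normed_vector, second_countable_topology}"
  shows "has_strong_integral M f I \<longleftrightarrow> has_bochner_integral M f I"
  unfolding has_strong_integral_def has_bochner_integral.simps
    strongly_measurable_iff_borel_measurable by auto

text \<open>\<open>g\<close> is a version of the conditional expectation of \<open>f\<close> given \<open>F\<close>; the choice \<open>A = space F\<close>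
  makes both functions integrable.\<close>

definition is_cond_expectation ::
    "'w measure \<Rightarrow> 'w measure \<Rightarrow> ('w \<Rightarrow> 'b::real_normed_vector) \<Rightarrow> ('w \<Rightarrow> 'b) \<Rightarrow> bool" where
  "is_cond_expectation M F f g \<longleftrightarrow>
     strongly_measurable F g \<and>
     (\<forall>A\<in>sets F. \<exists>I. has_strong_integral M (\<lambda>\<omega>. indicator A \<omega> *\<^sub>R f \<omega>) I \<and>
                       has_strong_integral M (\<lambda>\<omega>. indicator A \<omega> *\<^sub>R g \<omega>) I)"

definition gradient :: "('u::real_inner \<Rightarrow> real) \<Rightarrow> 'u \<Rightarrow> 'u" where
  "gradient f x = (THE D. GDERIV f x :> D)"

text \<open>The library's \<^const>\<open>closest_point\<close> is confined to class \<open>heine_borel\<close>, that is, to finite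
  dimension.\<close>

definition metric_projection :: "'u::metric_space set \<Rightarrow> 'u \<Rightarrow> 'u" where
  "metric_projection S x = arg_min_on (dist x) S"

definition bounded_linear_random_operator ::
    "'w measure \<Rightarrow> ('w \<Rightarrow> 'u::real_normed_vector \<Rightarrow> real) \<Rightarrow> bool" where
  "bounded_linear_random_operator P A \<longleftrightarrow>
     (AE \<omega> in P. bounded_linear (A \<omega>)) \<and> (\<forall>h. (\<lambda>\<omega>. A \<omega> h) \<in> borel_measurable P)"

text \<open>The remainder is required to be square integrable for small \<open>h\<close>, because the integral of a
  non-integrable function is 0 by convention.\<close>

definition L2_frechet_differentiable_at ::
    "'w measure \<Rightarrow> ('u::real_normed_vector \<Rightarrow> 'w \<Rightarrow> real) \<Rightarrow> 'u \<Rightarrow> bool" where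
  "L2_frechet_differentiable_at P f v \<longleftrightarrow>
     (\<exists>A. bounded_linear_random_operator P A \<and>
        (\<forall>\<^sub>F h in at 0. integrable P (\<lambda>\<omega>. (f (v + h) \<omega> - f v \<omega> - A \<omega> h)\<^sup>2)) \<and>
        ((\<lambda>h. sqrt (\<integral>\<omega>. (f (v + h) \<omega> - f v \<omega> - A \<omega> h)\<^sup>2 \<partial>P) / norm h) \<longlongrightarrow> 0) (at 0))"

definition expected_objective ::
    "'w measure \<Rightarrow> ('w \<Rightarrow> 'x) \<Rightarrow> ('u \<Rightarrow> 'x \<Rightarrow> real) \<Rightarrow> 'u \<Rightarrow> real" where
  "expected_objective P \<xi> J v = (\<integral>\<omega>. J v (\<xi> \<omega>) \<partial>P)"

text \<open>
  \<open>I\<close> is the set of iteration indices: \<open>{1..N}\<close> for a run of \<open>N\<close> iterations, \<open>{1..}\<close> for an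
  unlimited run. \<open>S\<close> is the measurable space in which the random vector takes its values. The
  samples are \<open>\<zeta> n\<close>; the sigma algebra generated by \<open>\<zeta> n\<close> has to be independent of the one
  generated by the tuple \<open>\<zeta> 1, \<dots>, \<zeta> (n - 1)\<close>.
\<close>

definition projected_stochastic_gradient ::
    "'w measure \<Rightarrow> 'x measure \<Rightarrow> ('w \<Rightarrow> 'x) \<Rightarrow> 'u::real_inner set \<Rightarrow> ('u \<Rightarrow> 'x \<Rightarrow> 'u) \<Rightarrow> 'u \<Rightarrow>
     nat set \<Rightarrow> (nat \<Rightarrow> real) \<Rightarrow> (nat \<Rightarrow> 'w \<Rightarrow> 'x) \<Rightarrow> (nat \<Rightarrow> 'w \<Rightarrow> 'u) \<Rightarrow> bool" where
  "projected_stochastic_gradient P S \<xi> U G u1 I t \<zeta> us \<longleftrightarrow>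
     u1 \<in> U \<and> (\<forall>\<omega>\<in>space P. us 1 \<omega> = u1) \<and>
     (\<forall>n\<in>I.
        \<zeta> n \<in> P \<rightarrow>\<^sub>M S \<and> distr P S (\<zeta> n) = distr P S \<xi> \<and>
        prob_space.indep_set P
          (sets (vimage_algebra (space P) (\<zeta> n) S))
          (sets (vimage_algebra (space P) (\<lambda>\<omega>. \<lambda>k\<in>{1..<n}. \<zeta> k \<omega>) (\<Pi>\<^sub>M k\<in>{1..<n}. S))) \<and>
        0 < t n \<and>
        (\<forall>\<omega>\<in>space P. us (Suc n) \<omega> = metric_projection U (us n \<omega> - t n *\<^sub>R G (us n \<omega>) (\<zeta> n \<omega>))))"

text \<open>The error \<open>r\<close>: \<open>EG n\<close> stands for (a version of) the conditional expectation of
  \<open>G (us n) (\<zeta> n)\<close> and \<open>dj\<close> for the gradient of the objective.\<close>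

definition gradient_error ::
    "('u \<Rightarrow> 'u::real_normed_vector) \<Rightarrow> (nat \<Rightarrow> 'w \<Rightarrow> 'u) \<Rightarrow> (nat \<Rightarrow> 'w \<Rightarrow> 'u) \<Rightarrow> nat \<Rightarrow> 'w \<Rightarrow> 'u" where
  "gradient_error dj us EG n \<omega> = EG n \<omega> - dj (us n \<omega>)"

definition bias ::
    "'w measure \<Rightarrow> ('u \<Rightarrow> 'u::real_normed_vector) \<Rightarrow> (nat \<Rightarrow> 'w \<Rightarrow> 'u) \<Rightarrow> (nat \<Rightarrow> 'w \<Rightarrow> 'u) \<Rightarrow> nat \<Rightarrow> ereal"
  where "bias P dj us EG n = esssup P (\<lambda>\<omega>. ereal (norm (gradient_error dj us EG n \<omega>)))"

definition stochastic_gradient_assumption ::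
    "'w measure \<Rightarrow> ('u \<Rightarrow> 'u::real_normed_vector) \<Rightarrow> ('u \<Rightarrow> 'x \<Rightarrow> 'u) \<Rightarrow> nat set \<Rightarrow>
     (nat \<Rightarrow> 'w \<Rightarrow> 'x) \<Rightarrow> (nat \<Rightarrow> 'w \<Rightarrow> 'u) \<Rightarrow> (nat \<Rightarrow> 'w measure) \<Rightarrow> (nat \<Rightarrow> 'w \<Rightarrow> 'u) \<Rightarrow> bool" where
  "stochastic_gradient_assumption P dj G I \<zeta> us F EG \<longleftrightarrow>
     (\<forall>n\<in>I. subalgebra P (F n)) \<and>
     (\<forall>m\<in>I. \<forall>n\<in>I. m \<le> n \<longrightarrow> sets (F m) \<subseteq> sets (F n)) \<and>
     (\<forall>n\<in>I. is_cond_expectation P (F n) (\<lambda>\<omega>. G (us n \<omega>) (\<zeta> n \<omega>)) (EG n)) \<and>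
     (\<forall>n\<in>I. strongly_measurable (F n) (us n)) \<and>
     (\<forall>n\<in>I. strongly_measurable (F n) (gradient_error dj us EG n)) \<and>
     (SUP n\<in>I. bias P dj us EG n) < \<infinity>"

definition averaged_iterate ::
    "(nat \<Rightarrow> real) \<Rightarrow> (nat \<Rightarrow> 'w \<Rightarrow> 'u::real_vector) \<Rightarrow> nat \<Rightarrow> nat \<Rightarrow> 'w \<Rightarrow> 'u" where
  "averaged_iterate t us i N \<omega> = (\<Sum>n=i..N. (t n / (\<Sum>l=i..N. t l)) *\<^sub>R us n \<omega>)"

end

theory Submission
  imports Defs
begin

text \<open>
  By nonexpansiveness of the metric projection, one step of the method satisfies
  \<open>|u\<^sub>n\<^sub>+\<^sub>1 - u|\<^sup>2 \<le> |u\<^sub>n - u|\<^sup>2 - 2 t\<^sub>n \<langle>u\<^sub>n - u, G(u\<^sub>n, \<xi>\<^sub>n)\<rangle> + t\<^sub>n\<^sup>2 |G(u\<^sub>n, \<xi>\<^sub>n)|\<^sup>2\<close>.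
  In expectation, the last term is at most \<open>t\<^sub>n\<^sup>2 M\<close>, because \<open>\<xi>\<^sub>n\<close> is independent of \<open>u\<^sub>n\<close>
  (\<open>second_moment_sg\<close>). In the middle term the stochastic gradient may be replaced by its conditional
  expectation \<open>\<nabla>j(u\<^sub>n) + r\<^sub>n\<close>, because \<open>u\<^sub>n\<close> is bounded and measurable with respect to the
  conditioning sigma algebra (\<open>is_cond_expectation_inner\<close>). Convexity gives
  \<open>\<langle>u\<^sub>n - u, \<nabla>j(u\<^sub>n)\<rangle> \<ge> j(u\<^sub>n) - j(u)\<close>, and the bias contributes at most \<open>b K\<^sub>n\<close>, where \<open>b\<close> bounds
  the diameter of the admissible set. Summing over \<open>n\<close>, the squared distances telescope, and
  Jensen's inequality turns the weighted sum of the gaps \<open>j(u\<^sub>n) - j(u)\<close> into the gap of the average \<open>v\<close>: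
  \<open>(\<Sum> t\<^sub>n) E[j(v) - j(u)] \<le> b\<^sup>2/2 + M/2 \<Sum> t\<^sub>n\<^sup>2 + b \<Sum> t\<^sub>n K\<^sub>n\<close> (\<open>averaged_gap\<close>). For both step
  size policies the right-hand side is bounded in \<open>N\<close>, while \<open>\<Sum> t\<^sub>n\<close> grows like \<open>sqrt N\<close>.

  The infinite-dimensional setting asks for two further arguments. The gradient of \<open>j\<close> has to be
  constructed: the expectation of the \<open>L\<^sup>2\<close>-derivative is linear, its continuity is a
  Banach-Steinhaus argument (\<open>bounded_linear_integral\<close>), and the Riesz representation supplies the
  gradient vector. Moreover the space need not be separable, so sums of Borel measurable functions
  need not be Borel measurable; the independence argument needs \<open>u\<^sub>n\<close> to be Borel measurable with
  respect to the past samples, and this is rescued by the separable ranges that strong measurability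
  of the iterates and of the stochastic gradients provides (\<open>borel_measurable_Pair_separable\<close>).
\<close>

section \<open>Projection and Riesz representation in Hilbert spaces\<close>

text \<open>A minimizing sequence is Cauchy: the midpoint of two of its members lies in the convex set, so by
  the parallelogram law two members that are nearly optimal are close to each other.\<close>

lemma nearest_point_exists:
  fixes S :: "'u::{real_inner, complete_space} set"
  assumes "S \<noteq> {}" "closed S" "convex S"
  shows "\<exists>y\<in>S. \<forall>z\<in>S. dist x y \<le> dist x z"
proof -
  define d where "d = (INF z\<in>S. (dist x z)\<^sup>2)"
  have bdd: "bdd_below ((\<lambda>z. (dist x z)\<^sup>2) ` S)"
    by (rule bdd_belowI[of _ 0]) auto
  have d_le: "d \<le> (dist x z)\<^sup>2" if "z \<in> S" for z
    unfolding d_def using bdd that by (rule cINF_lower)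
  have "\<exists>y\<in>S. (dist x y)\<^sup>2 < d + inverse (real (Suc n))" for n
    using cInf_lessD[of "(\<lambda>z. (dist x z)\<^sup>2) ` S" "d + inverse (real (Suc n))"] assms(1)
    unfolding d_def by auto
  then obtain y where yS: "\<And>n. y n \<in> S"
    and yd: "\<And>n. (dist x (y n))\<^sup>2 < d + inverse (real (Suc n))"
    by metis
  have gap: "(dist (y m) (y n))\<^sup>2 \<le> 2 * inverse (real (Suc m)) + 2 * inverse (real (Suc n))" for m n
  proof -
    \<comment> \<open>The distance of \<open>x\<close> to the midpoint is bounded below by the infimum.\<close>
    have "(1/2) *\<^sub>R y m + (1/2) *\<^sub>R y n \<in> S"
      using assms(3) yS[of m] yS[of n] by (rule convexD) auto
    then have "d \<le> (dist x ((1/2) *\<^sub>R y m + (1/2) *\<^sub>R y n))\<^sup>2"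
      by (rule d_le)
    moreover have "(dist (y m) (y n))\<^sup>2 = 2 * (dist x (y m))\<^sup>2 + 2 * (dist x (y n))\<^sup>2
        - 4 * (dist x ((1/2) *\<^sub>R y m + (1/2) *\<^sub>R y n))\<^sup>2"
      unfolding dist_norm power2_norm_eq_inner by (simp add: algebra_simps inner_commute)
    ultimately show ?thesis
      using yd[of m] yd[of n] by simp
  qed
  have "Cauchy y"
  proof (rule metric_CauchyI)
    fix e :: real assume "0 < e"
    obtain K where K: "inverse (real (Suc K)) < e\<^sup>2 / 4"
      using reals_Archimedean[of "e\<^sup>2 / 4"] \<open>0 < e\<close> by auto
    show "\<exists>K. \<forall>m\<ge>K. \<forall>n\<ge>K. dist (y m) (y n) < e"
    proof (intro exI allI impI)
      fix m n assume "K \<le> m" "K \<le> n"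
      then have "inverse (real (Suc m)) \<le> inverse (real (Suc K))"
        "inverse (real (Suc n)) \<le> inverse (real (Suc K))"
        by (simp_all add: field_simps)
      then have "(dist (y m) (y n))\<^sup>2 < e\<^sup>2"
        using gap[of m n] K by linarith
      then show "dist (y m) (y n) < e"
        using \<open>0 < e\<close> by (simp add: power_less_imp_less_base)
    qed
  qed
  then obtain l where l: "y \<longlonglongrightarrow> l"
    using Cauchy_convergent convergent_def by blast
  have "l \<in> S"
    using assms(2) yS l by (rule closed_sequentially)
  moreover have l_d: "(dist x l)\<^sup>2 \<le> d"
  proof (rule LIMSEQ_le)
    show "(\<lambda>n. (dist x (y n))\<^sup>2) \<longlonglongrightarrow> (dist x l)\<^sup>2"
      by (intro tendsto_intros l)
    show "(\<lambda>n. d + inverse (real (Suc n))) \<longlonglongrightarrow> d"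
      using tendsto_add[OF tendsto_const LIMSEQ_inverse_real_of_nat, of d] by simp
    show "\<exists>N. \<forall>n\<ge>N. (dist x (y n))\<^sup>2 \<le> d + inverse (real (Suc n))"
      using yd by (auto intro: less_imp_le)
  qed
  moreover have "dist x l \<le> dist x z" if "z \<in> S" for z
    by (rule power2_le_imp_le[OF order_trans[OF l_d d_le[OF that]] zero_le_dist])
  ultimately show ?thesis by blast
qed

lemma metric_projection_nearest:
  fixes S :: "'u::{real_inner, complete_space} set"
  assumes "S \<noteq> {}" "closed S" "convex S"
  shows "metric_projection S x \<in> S \<and> (\<forall>z\<in>S. dist x (metric_projection S x) \<le> dist x z)"
proof -
  obtain y where "y \<in> S" "\<forall>z\<in>S. dist x y \<le> dist x z"
    using nearest_point_exists[OF assms] by blast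
  note y = this
  show ?thesis
    unfolding metric_projection_def arg_min_on_def
  proof (rule arg_minI[of "\<lambda>z. z \<in> S" y "dist x"])
    show "y \<in> S" by fact
    show "\<not> dist x z < dist x y" if "z \<in> S" for z
      using y(2) that by (simp add: not_less)
    show "p \<in> S \<and> (\<forall>z\<in>S. dist x p \<le> dist x z)"
      if "p \<in> S" "\<forall>z. z \<in> S \<longrightarrow> \<not> dist x z < dist x p" for p
      using that by (simp add: not_less)
  qed
qed

text \<open>The variational inequalities that characterize the two projections, each tested with the other
  projection, add up to \<open>|p - q|\<^sup>2 \<le> \<langle>x - y, p - q\<rangle>\<close>.\<close>

lemma metric_projection_nonexpansive:
  fixes S :: "'u::{real_inner, complete_space} set"
  assumes "S \<noteq> {}" "closed S" "convex S"
  shows "dist (metric_projection S x) (metric_projection S y) \<le> dist x y"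
proof -
  let ?p = "metric_projection S x" and ?q = "metric_projection S y"
  note p = metric_projection_nearest[OF assms, of x] and q = metric_projection_nearest[OF assms, of y]
  have "(x - ?p) \<bullet> (?q - ?p) \<le> 0" "(y - ?q) \<bullet> (?p - ?q) \<le> 0"
    using any_closest_point_dot[OF assms(3,2) conjunct1[OF p] conjunct1[OF q] conjunct2[OF p]]
      any_closest_point_dot[OF assms(3,2) conjunct1[OF q] conjunct1[OF p] conjunct2[OF q]] .
  then have "(norm (?p - ?q))\<^sup>2 \<le> (x - y) \<bullet> (?p - ?q)"
    unfolding power2_norm_eq_inner by (simp add: algebra_simps inner_commute)
  also have "\<dots> \<le> norm (x - y) * norm (?p - ?q)"
    by (rule norm_cauchy_schwarz)
  finally have "norm (?p - ?q) * norm (?p - ?q) \<le> norm (x - y) * norm (?p - ?q)"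
    by (simp add: power2_eq_square)
  then have "norm (?p - ?q) \<le> norm (x - y)"
    using mult_right_le_imp_le[of "norm (?p - ?q)" "norm (?p - ?q)" "norm (x - y)"]
    by (cases "norm (?p - ?q) = 0") simp_all
  then show ?thesis by (simp add: dist_norm)
qed

lemma metric_projection_fixes:
  assumes "v \<in> S"
  shows "metric_projection S v = v"
proof -
  have "dist v (arg_min (dist v) (\<lambda>x. x \<in> S)) = dist v v"
    by (rule arg_min_equality[of "\<lambda>x. x \<in> S" v "dist v"]) (use assms in auto)
  then show ?thesis by (simp add: metric_projection_def arg_min_on_def)
qed

lemma metric_projection_dist_le:
  fixes S :: "'u::{real_inner, complete_space} set"
  assumes "closed S" "convex S" "v \<in> S"
  shows "norm (metric_projection S x - v) \<le> norm (x - v)"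
proof -
  have "S \<noteq> {}" using assms(3) by blast
  from metric_projection_nonexpansive[OF this assms(1,2), of x v]
  show ?thesis by (simp add: dist_norm metric_projection_fixes[OF assms(3)])
qed

lemma continuous_on_metric_projection:
  fixes S :: "'u::{real_inner, complete_space} set"
  assumes "S \<noteq> {}" "closed S" "convex S"
  shows "continuous_on UNIV (metric_projection S)"
proof (rule continuous_onI)
  fix x :: 'u and e :: real assume "0 < e"
  moreover have "dist (metric_projection S y) (metric_projection S x) \<le> e" if "dist y x < e" for y
    using metric_projection_nonexpansive[OF assms, of y x] that by linarith
  ultimately show "\<exists>d>0. \<forall>y\<in>UNIV. dist y x < d \<longrightarrow> dist (metric_projection S y) (metric_projection S x) \<le> e"
    by blast
qed

text \<open>The point \<open>x\<close> of the hyperplane \<open>T = 1\<close> that is nearest to the origin is orthogonal to the kernel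
  of \<open>T\<close>, so \<open>T\<close> is the inner product with \<open>x\<close> up to a factor.\<close>

lemma riesz_representation:
  fixes T :: "'u::{real_inner, complete_space} \<Rightarrow> real"
  assumes "bounded_linear T"
  obtains D where "\<And>h. T h = h \<bullet> D"
proof (cases "\<forall>h. T h = 0")
  case True
  then show ?thesis using that[of 0] by simp
next
  case False
  interpret T: bounded_linear T by fact
  let ?S = "T -` {1}"
  from False obtain k where k: "T k \<noteq> 0" by blast
  have "(1 / T k) *\<^sub>R k \<in> ?S" using k by (simp add: T.scaleR)
  then have ne: "?S \<noteq> {}" by blast
  have cl: "closed ?S"
    by (intro closed_vimage T.continuous_on continuous_on_id closed_singleton)
  have cv: "convex ?S"
    unfolding convex_def by (auto simp: T.add T.scaleR)
  obtain x where x: "x \<in> ?S" "\<forall>z\<in>?S. dist 0 x \<le> dist 0 z"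
    using nearest_point_exists[OF ne cl cv] by blast
  have orth: "x \<bullet> h = 0" if "T h = 0" for h
  proof -
    have "(0 - x) \<bullet> ((x + h) - x) \<le> 0" "(0 - x) \<bullet> ((x - h) - x) \<le> 0"
      using x that by (intro any_closest_point_dot[OF cv cl]; simp add: T.add T.diff)+
    then show ?thesis by simp
  qed
  have "x \<noteq> 0" using x(1) by auto
  show ?thesis
  proof (rule that[of "(1 / (x \<bullet> x)) *\<^sub>R x"])
    fix h
    \<comment> \<open>Every \<open>h\<close> splits into a kernel part and a multiple of \<open>x\<close>.\<close>
    have "T (h - T h *\<^sub>R x) = 0" using x(1) by (simp add: T.diff T.scaleR)
    from orth[OF this] have "x \<bullet> h = T h * (x \<bullet> x)" by (simp add: inner_diff_right)
    then show "T h = h \<bullet> ((1 / (x \<bullet> x)) *\<^sub>R x)"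
      using \<open>x \<noteq> 0\<close> by (simp add: inner_commute)
  qed
qed

section \<open>Gradients of convex functions and of expectations\<close>

lemma GDERIV_unique:
  assumes "GDERIV f x :> D" "GDERIV f x :> D'"
  shows "D = D'"
proof -
  have "(\<lambda>h. h \<bullet> D) = (\<lambda>h. h \<bullet> D')"
    using assms unfolding gderiv_def by (rule has_derivative_unique)
  then have "(D - D') \<bullet> D = (D - D') \<bullet> D'" by metis
  then have "(D - D') \<bullet> (D - D') = 0" by (simp add: inner_diff_right)
  then show ?thesis by simp
qed

lemma gradient_eq:
  assumes "GDERIV f x :> D"
  shows "gradient f x = D"
  unfolding gradient_def by (rule the_equality) (use assms GDERIV_unique in blast)+

text \<open>The difference quotients of \<open>f\<close> on the segment from \<open>v\<close> to \<open>w\<close> are bounded by the slope of the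
  chord; the gradient inequality is their limit. Only the directions that point into \<open>S\<close> enter, so
  \<open>S\<close> may have empty interior.\<close>

lemma convex_gradient_inequality:
  fixes f :: "'u::real_inner \<Rightarrow> real"
  assumes f: "convex_on S f" and v: "v \<in> S" and w: "w \<in> S" and D: "GDERIV f v :> D"
  shows "f v - f w \<le> (v - w) \<bullet> D"
proof -
  have "((\<lambda>s. f (v + s *\<^sub>R (w - v))) has_derivative (\<lambda>s. (s *\<^sub>R (w - v)) \<bullet> D)) (at 0)"
  proof (rule has_derivative_compose[of "\<lambda>s. v + s *\<^sub>R (w - v)" _ 0 UNIV f "\<lambda>h. h \<bullet> D"])
    show "((\<lambda>s. v + s *\<^sub>R (w - v)) has_derivative (\<lambda>s. s *\<^sub>R (w - v))) (at 0)"
      by (auto intro!: derivative_eq_intros)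
    show "(f has_derivative (\<lambda>h. h \<bullet> D)) (at (v + 0 *\<^sub>R (w - v)))"
      using D by (simp add: gderiv_def)
  qed
  then have "((\<lambda>s. f (v + s *\<^sub>R (w - v))) has_real_derivative ((w - v) \<bullet> D)) (at 0)"
    by (simp add: has_field_derivative_def mult.commute[of _ "(w - v) \<bullet> D"] lambda_one)
  then have "((\<lambda>s. (f (v + s *\<^sub>R (w - v)) - f v) / s) \<longlongrightarrow> (w - v) \<bullet> D) (at 0)"
    unfolding DERIV_def by simp
  then have "((\<lambda>s. (f (v + s *\<^sub>R (w - v)) - f v) / s) \<longlongrightarrow> (w - v) \<bullet> D) (at_right 0)"
    by (rule filterlim_mono[OF _ order_refl]) (simp add: at_within_le_at)
  moreover have "\<forall>\<^sub>F s in at_right 0. (f (v + s *\<^sub>R (w - v)) - f v) / s \<le> f w - f v"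
    unfolding eventually_at_right_field
  proof (intro exI[of _ 1] conjI allI impI zero_less_one)
    fix s :: real assume s: "0 < s" "s < 1"
    have "f ((1 - s) *\<^sub>R v + s *\<^sub>R w) \<le> (1 - s) * f v + s * f w"
      using s v w by (intro convex_onD[OF f]) auto
    moreover have "(1 - s) *\<^sub>R v + s *\<^sub>R w = v + s *\<^sub>R (w - v)"
      by (simp add: algebra_simps)
    ultimately have "f (v + s *\<^sub>R (w - v)) - f v \<le> (f w - f v) * s"
      by (simp add: algebra_simps)
    then show "(f (v + s *\<^sub>R (w - v)) - f v) / s \<le> f w - f v"
      using s by (simp add: divide_le_eq)
  qed
  ultimately have "(w - v) \<bullet> D \<le> f w - f v"
    by (intro tendsto_upperbound) auto
  then show ?thesis by (simp add: inner_diff_left)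
qed

text \<open>The operator norms of \<open>A \<omega>\<close> need not be measurable in \<open>\<omega>\<close>, let alone integrable, so continuity
  cannot be read off from a pointwise bound. Instead the sublevel sets of \<open>h \<mapsto> E|A h|\<close> are closed by
  Fatou's lemma and cover the space; by Baire's theorem one of them contains a ball, and linearity
  moves this bound to a neighbourhood of the origin.\<close>

lemma bounded_linear_integral:
  fixes A :: "'w \<Rightarrow> 'u::{real_normed_vector, complete_space} \<Rightarrow> real"
  assumes lin: "AE \<omega> in P. bounded_linear (A \<omega>)"
    and int: "\<And>h. integrable P (\<lambda>\<omega>. A \<omega> h)"
  shows "bounded_linear (\<lambda>h. \<integral>\<omega>. A \<omega> h \<partial>P)"
proof -
  let ?T = "\<lambda>h. \<integral>\<omega>. A \<omega> h \<partial>P"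
  let ?L = "\<lambda>h. \<integral>\<^sup>+\<omega>. ennreal \<bar>A \<omega> h\<bar> \<partial>P"
  have [measurable]: "(\<lambda>\<omega>. A \<omega> h) \<in> borel_measurable P" for h
    using int by blast
  have T_add: "?T (h + k) = ?T h + ?T k" for h k
  proof -
    have "?T (h + k) = (\<integral>\<omega>. A \<omega> h + A \<omega> k \<partial>P)"
      by (rule integral_cong_AE) (use lin in \<open>auto elim!: eventually_mono simp: linear_simps\<close>)
    then show ?thesis using int by simp
  qed
  have T_scale: "?T (r *\<^sub>R h) = r * ?T h" for r h
  proof -
    have "?T (r *\<^sub>R h) = (\<integral>\<omega>. r * A \<omega> h \<partial>P)"
      by (rule integral_cong_AE) (use lin in \<open>auto elim!: eventually_mono simp: linear_simps\<close>)
    then show ?thesis by simp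
  qed
  have T_le: "ennreal \<bar>?T h\<bar> \<le> ?L h" for h
    using integral_norm_bound_ennreal[OF int[of h]] by simp
  define B where "B m = {h. ?L h \<le> ennreal (real m)}" for m :: nat
  have closed_B: "closed (B m)" for m
    unfolding closed_sequential_limits
  proof (intro allI impI, elim conjE)
    fix x l assume x: "\<forall>n. x n \<in> B m" and l: "x \<longlonglongrightarrow> l"
    have "?L l = (\<integral>\<^sup>+\<omega>. liminf (\<lambda>n. ennreal \<bar>A \<omega> (x n)\<bar>) \<partial>P)"
    proof (rule nn_integral_cong_AE, use lin in eventually_elim)
      fix \<omega> assume "bounded_linear (A \<omega>)"
      from bounded_linear.tendsto[OF this l]
      have "(\<lambda>n. ennreal \<bar>A \<omega> (x n)\<bar>) \<longlonglongrightarrow> ennreal \<bar>A \<omega> l\<bar>"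
        by (intro tendsto_ennrealI tendsto_rabs)
      then show "ennreal \<bar>A \<omega> l\<bar> = liminf (\<lambda>n. ennreal \<bar>A \<omega> (x n)\<bar>)"
        by (intro lim_imp_Liminf[symmetric]) auto
    qed
    also have "\<dots> \<le> liminf (\<lambda>n. ?L (x n))"
      by (rule nn_integral_liminf) measurable
    also have "\<dots> \<le> limsup (\<lambda>n. ?L (x n))"
      by (rule Liminf_le_Limsup) simp
    also have "\<dots> \<le> ennreal (real m)"
      by (rule Limsup_bounded) (use x in \<open>auto simp: B_def\<close>)
    finally show "l \<in> B m" by (simp add: B_def)
  qed
  have "(\<Union>m. B m) = UNIV"
  proof (intro set_eqI iffI UNIV_I)
    fix h
    have "?L h < \<infinity>" using int[of h] unfolding integrable_iff_bounded by simp
    then obtain r where r: "?L h = ennreal r" "0 \<le> r" by (cases "?L h") auto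
    obtain m :: nat where "r \<le> real m" using real_arch_simple by blast
    then have "h \<in> B m" using r by (simp add: B_def ennreal_leI)
    then show "h \<in> (\<Union>m. B m)" by blast
  qed
  then have "\<not> (\<forall>m. interior (B m) = {})"
    using Baire_category_alt[OF disjI1[OF completely_metrizable_space_euclidean], of "range B"] closed_B
    by (fastforce simp: image_iff)
  then obtain m x where "x \<in> interior (B m)" by blast
  then obtain r where r: "0 < r" "ball x r \<subseteq> B m" by (auto simp: mem_interior)
  have small: "\<bar>?T h\<bar> \<le> 2 * real m" if "norm h < r" for h
  proof -
    have "x + h \<in> B m" "x \<in> B m" using r that by (auto simp: dist_norm)
    have "?L h \<le> (\<integral>\<^sup>+\<omega>. ennreal \<bar>A \<omega> (x + h)\<bar> + ennreal \<bar>A \<omega> x\<bar> \<partial>P)"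
    proof (rule nn_integral_mono_AE, use lin in eventually_elim)
      fix \<omega> assume "bounded_linear (A \<omega>)"
      then have "\<bar>A \<omega> h\<bar> \<le> \<bar>A \<omega> (x + h)\<bar> + \<bar>A \<omega> x\<bar>"
        by (simp add: linear_simps)
      from ennreal_leI[OF this]
      show "ennreal \<bar>A \<omega> h\<bar> \<le> ennreal \<bar>A \<omega> (x + h)\<bar> + ennreal \<bar>A \<omega> x\<bar>"
        by simp
    qed
    also have "\<dots> = ?L (x + h) + ?L x"
      by (rule nn_integral_add) auto
    also have "\<dots> \<le> ennreal (real m) + ennreal (real m)"
      using \<open>x + h \<in> B m\<close> \<open>x \<in> B m\<close> by (intro add_mono) (auto simp: B_def)
    also have "\<dots> = ennreal (2 * real m)"
      by (subst ennreal_plus[symmetric]) auto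
    finally have "ennreal \<bar>?T h\<bar> \<le> ennreal (2 * real m)"
      using T_le order_trans by blast
    then show ?thesis by simp
  qed
  show ?thesis
  proof (rule bounded_linear_intro)
    show "?T (h + k) = ?T h + ?T k" for h k by (rule T_add)
    show "?T (c *\<^sub>R h) = c *\<^sub>R ?T h" for c h using T_scale by simp
    show "norm (?T h) \<le> norm h * (4 * real m / r)" for h
    proof (cases "h = 0")
      case True
      then show ?thesis using T_scale[of 0 h] by simp
    next
      case False
      let ?c = "r / (2 * norm h)"
      have "\<bar>?T (?c *\<^sub>R h)\<bar> \<le> 2 * real m"
        using False r(1) by (intro small) simp
      then have "?c * \<bar>?T h\<bar> \<le> 2 * real m"
        unfolding T_scale abs_mult using r(1) by simp
      then show ?thesis
        using False r(1) by (simp add: field_simps)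
    qed
  qed
qed

text \<open>The expectation of the \<open>L\<^sup>2\<close>-derivative \<open>A\<close> is the derivative of the expectation, since
  \<open>(E R)\<^sup>2 \<le> E R\<^sup>2\<close> for the remainder \<open>R\<close>. That \<open>A h\<close> is integrable follows for small \<open>h\<close> from the
  integrability of the function values and of the remainder, and for all \<open>h\<close> by homogeneity.\<close>

lemma expectation_GDERIV:
  fixes f :: "'u::{real_inner, complete_space} \<Rightarrow> 'w \<Rightarrow> real"
  assumes P: "prob_space P" and V: "open V" "v \<in> V"
    and f: "\<And>w. w \<in> V \<Longrightarrow> integrable P (f w)"
    and diff: "L2_frechet_differentiable_at P f v"
  shows "\<exists>D. GDERIV (\<lambda>w. \<integral>\<omega>. f w \<omega> \<partial>P) v :> D"
proof -
  interpret prob_space P by fact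
  obtain A where A: "AE \<omega> in P. bounded_linear (A \<omega>)"
    and A_meas [measurable]: "\<And>h. (\<lambda>\<omega>. A \<omega> h) \<in> borel_measurable P"
    and sq: "\<forall>\<^sub>F h in at 0. integrable P (\<lambda>\<omega>. (f (v + h) \<omega> - f v \<omega> - A \<omega> h)\<^sup>2)"
    and lim: "((\<lambda>h. sqrt (\<integral>\<omega>. (f (v + h) \<omega> - f v \<omega> - A \<omega> h)\<^sup>2 \<partial>P) / norm h) \<longlongrightarrow> 0) (at 0)"
    using diff unfolding L2_frechet_differentiable_at_def bounded_linear_random_operator_def by blast
  let ?R = "\<lambda>h \<omega>. f (v + h) \<omega> - f v \<omega> - A \<omega> h"
  obtain e where e: "0 < e" "ball v e \<subseteq> V" using V openE by blast
  obtain e' where e': "0 < e'" "\<And>h. h \<noteq> 0 \<Longrightarrow> norm h < e' \<Longrightarrow> integrable P (\<lambda>\<omega>. (?R h \<omega>)\<^sup>2)"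
    using sq unfolding eventually_at by auto
  define d where "d = min e e'"
  have "0 < d" using e e' by (simp add: d_def)
  have fV [simp]: "integrable P (f (v + h))" if "norm h < d" for h
  proof -
    have "v + h \<in> ball v e" using that by (simp add: d_def dist_norm)
    then show ?thesis using f e(2) by blast
  qed
  have fv [simp]: "integrable P (f v)" using f V by blast
  have R_int: "integrable P (?R h)" if "h \<noteq> 0" "norm h < d" for h
  proof (rule square_integrable_imp_integrable)
    show "?R h \<in> borel_measurable P"
      using borel_measurable_integrable[OF fV[OF that(2)]] borel_measurable_integrable[OF fv] by measurable
    show "integrable P (\<lambda>\<omega>. (?R h \<omega>)\<^sup>2)" using e'(2) that by (simp add: d_def)
  qed
  have A_small: "integrable P (\<lambda>\<omega>. A \<omega> h)" if "h \<noteq> 0" "norm h < d" for h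
  proof -
    have "integrable P (\<lambda>\<omega>. (f (v + h) \<omega> - f v \<omega>) - ?R h \<omega>)"
      by (intro Bochner_Integration.integrable_diff fV fv R_int that)
    then show ?thesis by simp
  qed
  have A_int: "integrable P (\<lambda>\<omega>. A \<omega> h)" for h
  proof (cases "h = 0")
    case True
    have "AE \<omega> in P. A \<omega> h = 0" using A by eventually_elim (simp add: True linear_simps)
    then show ?thesis by (subst integrable_cong_AE[where g="\<lambda>_. 0"]) auto
  next
    case False
    let ?c = "d / (2 * norm h)"
    have "integrable P (\<lambda>\<omega>. (1 / ?c) * A \<omega> (?c *\<^sub>R h))"
      using False \<open>0 < d\<close> by (intro integrable_mult_right A_small) auto
    moreover have "AE \<omega> in P. A \<omega> h = (1 / ?c) * A \<omega> (?c *\<^sub>R h)"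
      using A by eventually_elim (use False \<open>0 < d\<close> in \<open>simp add: linear_simps\<close>)
    ultimately show ?thesis by (subst integrable_cong_AE) auto
  qed
  let ?T = "\<lambda>h. \<integral>\<omega>. A \<omega> h \<partial>P"
  let ?F = "\<lambda>w. \<integral>\<omega>. f w \<omega> \<partial>P"
  have T: "bounded_linear ?T" using A A_int by (rule bounded_linear_integral)
  obtain D where D: "\<And>h. ?T h = h \<bullet> D" using riesz_representation[OF T] by blast
  have "((\<lambda>h. norm (?F (v + h) - ?F v - ?T h) / norm h) \<longlongrightarrow> 0) (at 0)"
  proof (rule tendsto_sandwich[OF _ _ tendsto_const lim])
    show "\<forall>\<^sub>F h in at 0. 0 \<le> norm (?F (v + h) - ?F v - ?T h) / norm h" by simp
    show "\<forall>\<^sub>F h in at 0. norm (?F (v + h) - ?F v - ?T h) / norm h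
        \<le> sqrt (\<integral>\<omega>. (?R h \<omega>)\<^sup>2 \<partial>P) / norm h"
      unfolding eventually_at
    proof (intro exI[of _ d] conjI ballI impI \<open>0 < d\<close>)
      fix h :: 'u assume "h \<noteq> 0 \<and> dist h 0 < d"
      then have h: "h \<noteq> 0" "norm h < d" by auto
      have "?F (v + h) - ?F v - ?T h = expectation (?R h)"
        using fV[OF h(2)] A_int by simp
      \<comment> \<open>The variance of the remainder is nonnegative.\<close>
      moreover have "(expectation (?R h))\<^sup>2 \<le> expectation (\<lambda>\<omega>. (?R h \<omega>)\<^sup>2)"
        using variance_positive[of "?R h"] e'(2)[OF h(1)] h(2) R_int[OF h]
        by (subst (asm) variance_eq) (auto simp: d_def)
      ultimately show "norm (?F (v + h) - ?F v - ?T h) / norm h \<le> sqrt (\<integral>\<omega>. (?R h \<omega>)\<^sup>2 \<partial>P) / norm h"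
        by (intro divide_right_mono) (auto intro: real_le_rsqrt simp: real_le_rsqrt)
    qed
  qed
  with T have "(?F has_derivative ?T) (at v)" unfolding has_derivative_at by simp
  then show ?thesis unfolding gderiv_def D by blast
qed

section \<open>Strongly measurable functions\<close>

lemma strongly_measurable_borel:
  fixes f :: "'w \<Rightarrow> 'b::metric_space"
  assumes "strongly_measurable N f"
  shows "f \<in> borel_measurable N"
proof -
  obtain s where s: "\<And>i. simple_function N (s i)" "\<And>\<omega>. \<omega> \<in> space N \<Longrightarrow> (\<lambda>i. s i \<omega>) \<longlonglongrightarrow> f \<omega>"
    using assms unfolding strongly_measurable_def by blast
  show ?thesis
    by (rule borel_measurable_LIMSEQ_metric[OF borel_measurable_simple_function[OF s(1)] s(2)])
qed

lemma strongly_measurable_const: "strongly_measurable N (\<lambda>_. c)"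
  unfolding strongly_measurable_def by (intro exI[of _ "\<lambda>_ _. c"]) auto

lemma strongly_measurable_simple: "simple_function N f \<Longrightarrow> strongly_measurable N f"
  unfolding strongly_measurable_def by (intro exI[of _ "\<lambda>_. f"]) auto

text \<open>Simple functions are stable under every binary operation, so strong measurability passes through
  every continuous one. This is the source of all arithmetic rules below; for Borel measurability in
  place of strong measurability they can fail in nonseparable spaces.\<close>

lemma strongly_measurable_comp2:
  fixes f :: "'w \<Rightarrow> 'a::topological_space" and g :: "'w \<Rightarrow> 'b::topological_space"
    and h :: "'a \<times> 'b \<Rightarrow> 'c::topological_space"
  assumes "strongly_measurable N f" "strongly_measurable N g" "continuous_on UNIV h"
  shows "strongly_measurable N (\<lambda>\<omega>. h (f \<omega>, g \<omega>))"
proof -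
  obtain s where s: "\<And>i. simple_function N (s i)" "\<And>\<omega>. \<omega> \<in> space N \<Longrightarrow> (\<lambda>i. s i \<omega>) \<longlonglongrightarrow> f \<omega>"
    using assms(1) unfolding strongly_measurable_def by blast
  obtain r where r: "\<And>i. simple_function N (r i)" "\<And>\<omega>. \<omega> \<in> space N \<Longrightarrow> (\<lambda>i. r i \<omega>) \<longlonglongrightarrow> g \<omega>"
    using assms(2) unfolding strongly_measurable_def by blast
  show ?thesis
    unfolding strongly_measurable_def
  proof (intro exI[of _ "\<lambda>i \<omega>. h (s i \<omega>, r i \<omega>)"] conjI allI ballI)
    show "simple_function N (\<lambda>\<omega>. h (s i \<omega>, r i \<omega>))" for i
      using simple_function_compose2[OF s(1) r(1), of "\<lambda>x y. h (x, y)" i i] by simp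
    show "(\<lambda>i. h (s i \<omega>, r i \<omega>)) \<longlonglongrightarrow> h (f \<omega>, g \<omega>)" if "\<omega> \<in> space N" for \<omega>
      by (rule continuous_on_tendsto_compose[OF assms(3) tendsto_Pair[OF s(2)[OF that] r(2)[OF that]]]) auto
  qed
qed

lemma strongly_measurable_diff:
  fixes f g :: "'w \<Rightarrow> 'b::real_normed_vector"
  assumes "strongly_measurable N f" "strongly_measurable N g"
  shows "strongly_measurable N (\<lambda>\<omega>. f \<omega> - g \<omega>)"
  using strongly_measurable_comp2[OF assms, of "\<lambda>p. fst p - snd p"]
  by (simp add: continuous_on_fst continuous_on_snd continuous_on_diff)

lemma strongly_measurable_add:
  fixes f g :: "'w \<Rightarrow> 'b::real_normed_vector"
  assumes "strongly_measurable N f" "strongly_measurable N g"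
  shows "strongly_measurable N (\<lambda>\<omega>. f \<omega> + g \<omega>)"
  using strongly_measurable_comp2[OF assms, of "\<lambda>p. fst p + snd p"]
  by (simp add: continuous_on_fst continuous_on_snd continuous_on_add)

lemma strongly_measurable_scaleR:
  fixes f :: "'w \<Rightarrow> 'b::real_normed_vector"
  assumes "strongly_measurable N f"
  shows "strongly_measurable N (\<lambda>\<omega>. c *\<^sub>R f \<omega>)"
  using strongly_measurable_comp2[OF assms assms, of "\<lambda>p. c *\<^sub>R fst p"]
  by (simp add: continuous_on_fst continuous_on_scaleR)

lemma strongly_measurable_sum:
  fixes f :: "'i \<Rightarrow> 'w \<Rightarrow> 'b::real_normed_vector"
  assumes "\<And>i. i \<in> I \<Longrightarrow> strongly_measurable N (f i)"
  shows "strongly_measurable N (\<lambda>\<omega>. \<Sum>i\<in>I. f i \<omega>)"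
  using assms
proof (induction I rule: infinite_finite_induct)
  case (insert i I)
  then show ?case by (simp add: strongly_measurable_add)
qed (simp_all add: strongly_measurable_const)

lemma strongly_measurable_inner:
  fixes f g :: "'w \<Rightarrow> 'b::real_inner"
  assumes "strongly_measurable N f" "strongly_measurable N g"
  shows "(\<lambda>\<omega>. f \<omega> \<bullet> g \<omega>) \<in> borel_measurable N"
  using strongly_measurable_comp2[OF assms, of "\<lambda>p. fst p \<bullet> snd p"]
  by (intro strongly_measurable_borel) (simp add: continuous_on_fst continuous_on_snd continuous_on_inner)

lemma strongly_measurable_subalgebra:
  assumes "subalgebra N F" "strongly_measurable F f"
  shows "strongly_measurable N f"
proof -
  have "simple_function N s" if "simple_function F s" for s :: "'a \<Rightarrow> 'b"
    using that assms(1) unfolding simple_function_def subalgebra_def by auto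
  then show ?thesis
    using assms unfolding strongly_measurable_def subalgebra_def by metis
qed

lemma borel_measurable_continuous_comp:
  assumes "f \<in> borel_measurable N" "continuous_on UNIV h"
  shows "(\<lambda>\<omega>. h (f \<omega>)) \<in> borel_measurable N"
  by (rule measurable_compose[OF assms(1) borel_measurable_continuous_onI[OF assms(2)]])

lemma strongly_measurable_norm:
  fixes f :: "'w \<Rightarrow> 'b::real_normed_vector"
  assumes "strongly_measurable N f"
  shows "(\<lambda>\<omega>. norm (f \<omega>)) \<in> borel_measurable N"
  using strongly_measurable_borel[OF assms]
  by (rule borel_measurable_continuous_comp) (intro continuous_intros)

lemma strongly_measurable_separable_range:
  fixes f :: "'w \<Rightarrow> 'b::metric_space"
  assumes "strongly_measurable N f"
  obtains C where "countable C" "f ` space N \<subseteq> closure C"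
proof -
  obtain s where s: "\<And>i. simple_function N (s i)" "\<And>\<omega>. \<omega> \<in> space N \<Longrightarrow> (\<lambda>i. s i \<omega>) \<longlonglongrightarrow> f \<omega>"
    using assms unfolding strongly_measurable_def by blast
  show ?thesis
  proof (rule that[of "\<Union>i::nat. s i ` space N"])
    show "countable (\<Union>i::nat. s i ` space N)"
      using s(1) by (intro countable_UN countableI_type countable_finite) (auto simp: simple_function_def)
    show "f ` space N \<subseteq> closure (\<Union>i::nat. s i ` space N)"
    proof
      fix x assume "x \<in> f ` space N"
      then obtain \<omega> where "\<omega> \<in> space N" "x = f \<omega>" by blast
      then show "x \<in> closure (\<Union>i::nat. s i ` space N)"
        unfolding closure_sequential using s(2) by (intro exI[of _ "\<lambda>i. s i \<omega>"]) auto
    qed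
  qed
qed

text \<open>In general the Borel sets of a product of nonseparable spaces are more than the product sigma
  algebra. If both ranges are separable, countably many products of balls with rational radii, all
  contained in a given open set, cover the part of it that the pair can reach.\<close>

lemma borel_measurable_Pair_separable:
  fixes f :: "'w \<Rightarrow> 'a::metric_space" and g :: "'w \<Rightarrow> 'b::metric_space"
  assumes f: "f \<in> borel_measurable N" and g: "g \<in> borel_measurable N"
    and C: "countable C" "f ` space N \<subseteq> closure C"
    and D: "countable D" "g ` space N \<subseteq> closure D"
  shows "(\<lambda>\<omega>. (f \<omega>, g \<omega>)) \<in> borel_measurable N"
proof (rule borel_measurableI)
  fix W :: "('a \<times> 'b) set" assume W: "open W"
  define K where "K = {(c, d, q). c \<in> C \<and> d \<in> D \<and> q \<in> \<rat> \<and> ball c q \<times> ball d q \<subseteq> W}"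
  have "K \<subseteq> C \<times> D \<times> \<rat>" unfolding K_def by auto
  then have K: "countable K"
    by (rule countable_subset) (intro countable_SIGMA C D countable_rat)
  have "(\<lambda>\<omega>. (f \<omega>, g \<omega>)) -` W \<inter> space N
      = (\<Union>(c, d, q)\<in>K. (f -` ball c q \<inter> space N) \<inter> (g -` ball d q \<inter> space N))" (is "_ = ?U")
  proof (intro equalityI subsetI)
    fix \<omega> assume "\<omega> \<in> (\<lambda>\<omega>. (f \<omega>, g \<omega>)) -` W \<inter> space N"
    then have \<omega>: "(f \<omega>, g \<omega>) \<in> W" "\<omega> \<in> space N" by auto
    obtain A B where AB: "open A" "open B" "f \<omega> \<in> A" "g \<omega> \<in> B" "A \<times> B \<subseteq> W"
      using open_prod_elim[OF W \<omega>(1)] by (metis mem_Times_iff fst_conv snd_conv)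
    obtain a where a: "0 < a" "ball (f \<omega>) a \<subseteq> A" using AB openE by blast
    obtain b where b: "0 < b" "ball (g \<omega>) b \<subseteq> B" using AB openE by blast
    obtain q where q: "q \<in> \<rat>" "0 < q" "q < min a b / 2"
      using Rats_dense_in_real[of 0 "min a b / 2"] a b by auto
    obtain c where c: "c \<in> C" "dist c (f \<omega>) < q"
      using closure_approachable[of "f \<omega>" C] C(2) \<omega>(2) q(2) by blast
    obtain d where d: "d \<in> D" "dist d (g \<omega>) < q"
      using closure_approachable[of "g \<omega>" D] D(2) \<omega>(2) q(2) by blast
    have "ball c q \<subseteq> ball (f \<omega>) a"
    proof
      fix y assume "y \<in> ball c q"
      then show "y \<in> ball (f \<omega>) a"
        using c(2) q(3) dist_triangle[of "f \<omega>" y c] by (simp add: dist_commute)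
    qed
    moreover have "ball d q \<subseteq> ball (g \<omega>) b"
    proof
      fix y assume "y \<in> ball d q"
      then show "y \<in> ball (g \<omega>) b"
        using d(2) q(3) dist_triangle[of "g \<omega>" y d] by (simp add: dist_commute)
    qed
    ultimately have "(c, d, q) \<in> K"
      using a(2) b(2) AB(5) c(1) d(1) q(1) unfolding K_def by blast
    then show "\<omega> \<in> ?U" using c d \<omega>(2) by (intro UN_I[of "(c, d, q)"]) auto
  next
    fix \<omega> assume "\<omega> \<in> ?U"
    then show "\<omega> \<in> (\<lambda>\<omega>. (f \<omega>, g \<omega>)) -` W \<inter> space N" by (auto simp: K_def)
  qed
  moreover have "?U \<in> sets N"
    using f g by (intro sets.countable_UN'' K) (auto intro!: sets.Int measurable_sets[of _ _ borel])
  ultimately show "(\<lambda>\<omega>. (f \<omega>, g \<omega>)) -` W \<inter> space N \<in> sets N" by simp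
qed

section \<open>Strong integrals and conditional expectations\<close>

text \<open>A functional maps the strong integral to the ordinary integral of a real function, for which the
  usual calculus is available.\<close>

lemma has_strong_integral_linear:
  fixes f :: "'w \<Rightarrow> 'b::real_normed_vector" and T :: "'b \<Rightarrow> real"
  assumes f: "has_strong_integral P f I" and T: "bounded_linear T"
  shows "has_bochner_integral P (\<lambda>\<omega>. T (f \<omega>)) (T I)"
proof -
  interpret T: bounded_linear T by fact
  obtain s where fm: "strongly_measurable P f"
    and s: "\<And>i. Bochner_Integration.simple_bochner_integrable P (s i)"
    and L1: "(\<lambda>i. \<integral>\<^sup>+\<omega>. ennreal (norm (f \<omega> - s i \<omega>)) \<partial>P) \<longlonglongrightarrow> 0"
    and I: "(\<lambda>i. Bochner_Integration.simple_bochner_integral P (s i)) \<longlonglongrightarrow> I"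
    using f unfolding has_strong_integral_def by blast
  obtain K where K: "K > 0" "\<And>x. norm (T x) \<le> norm x * K" using T.pos_bounded by blast
  have sm: "strongly_measurable P (s i)" for i
    using s[of i] by (auto intro: strongly_measurable_simple elim: simple_bochner_integrable.cases)
  have nm [measurable]: "(\<lambda>\<omega>. norm (f \<omega> - s i \<omega>)) \<in> borel_measurable P" for i
    by (intro strongly_measurable_norm strongly_measurable_diff fm sm)
  show ?thesis
  proof (rule has_bochner_integral.intros[of _ _ "\<lambda>i \<omega>. T (s i \<omega>)"])
    show "(\<lambda>\<omega>. T (f \<omega>)) \<in> borel_measurable P"
      by (rule borel_measurable_continuous_comp[OF strongly_measurable_borel[OF fm]])
        (intro T.continuous_on continuous_on_id)
    show "Bochner_Integration.simple_bochner_integrable P (\<lambda>\<omega>. T (s i \<omega>))" for i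
      using simple_bochner_integrable_compose2[of "\<lambda>x y. T x", OF _ s s] T.zero by simp
    show "(\<lambda>i. Bochner_Integration.simple_bochner_integral P (\<lambda>\<omega>. T (s i \<omega>))) \<longlonglongrightarrow> T I"
      using T.tendsto[OF I] by (simp add: simple_bochner_integral_linear[OF T.linear_axioms s])
    show "(\<lambda>i. \<integral>\<^sup>+\<omega>. norm (T (f \<omega>) - T (s i \<omega>)) \<partial>P) \<longlonglongrightarrow> 0"
    proof (rule tendsto_sandwich[OF _ _ tendsto_const])
      show "\<forall>\<^sub>F i in sequentially. 0 \<le> (\<integral>\<^sup>+\<omega>. norm (T (f \<omega>) - T (s i \<omega>)) \<partial>P)" by simp
      show "\<forall>\<^sub>F i in sequentially. (\<integral>\<^sup>+\<omega>. norm (T (f \<omega>) - T (s i \<omega>)) \<partial>P)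
          \<le> ennreal K * (\<integral>\<^sup>+\<omega>. norm (f \<omega> - s i \<omega>) \<partial>P)"
      proof (intro always_eventually allI)
        fix i
        have "(\<integral>\<^sup>+\<omega>. norm (T (f \<omega>) - T (s i \<omega>)) \<partial>P) \<le> (\<integral>\<^sup>+\<omega>. ennreal K * norm (f \<omega> - s i \<omega>) \<partial>P)"
          using K by (intro nn_integral_mono)
            (auto simp: T.diff[symmetric] ennreal_mult[symmetric] mult.commute)
        also have "\<dots> = ennreal K * (\<integral>\<^sup>+\<omega>. norm (f \<omega> - s i \<omega>) \<partial>P)"
          by (rule nn_integral_cmult) measurable
        finally show "(\<integral>\<^sup>+\<omega>. norm (T (f \<omega>) - T (s i \<omega>)) \<partial>P) \<le> ennreal K * (\<integral>\<^sup>+\<omega>. norm (f \<omega> - s i \<omega>) \<partial>P)" .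
      qed
      show "(\<lambda>i. ennreal K * (\<integral>\<^sup>+\<omega>. norm (f \<omega> - s i \<omega>) \<partial>P)) \<longlonglongrightarrow> 0"
        using ennreal_tendsto_cmult[OF _ L1, of "ennreal K"] by simp
    qed
  qed
qed

lemma has_strong_integral_integrable_norm:
  fixes f :: "'w \<Rightarrow> 'b::real_normed_vector"
  assumes f: "has_strong_integral P f I"
  shows "integrable P (\<lambda>\<omega>. norm (f \<omega>))"
proof -
  obtain s where fm: "strongly_measurable P f"
    and s: "\<And>i. Bochner_Integration.simple_bochner_integrable P (s i)"
    and L1: "(\<lambda>i. \<integral>\<^sup>+\<omega>. ennreal (norm (f \<omega> - s i \<omega>)) \<partial>P) \<longlonglongrightarrow> 0"
    using f unfolding has_strong_integral_def by blast
  have sm: "strongly_measurable P (s i)" for i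
    using s[of i] by (auto intro: strongly_measurable_simple elim: simple_bochner_integrable.cases)
  have [measurable]: "(\<lambda>\<omega>. norm (f \<omega> - s i \<omega>)) \<in> borel_measurable P" "(\<lambda>\<omega>. norm (s i \<omega>)) \<in> borel_measurable P" for i
    by (intro strongly_measurable_norm strongly_measurable_diff fm sm)+
  obtain i where i: "(\<integral>\<^sup>+\<omega>. ennreal (norm (f \<omega> - s i \<omega>)) \<partial>P) < 1"
    using order_tendstoD(2)[OF L1, of 1] by (auto simp: eventually_sequentially)
  have "Bochner_Integration.simple_bochner_integrable P (\<lambda>\<omega>. norm (s i \<omega>))"
    using simple_bochner_integrable_compose2[of "\<lambda>x y. norm x", OF _ s s] by simp
  then have "integrable P (\<lambda>\<omega>. norm (s i \<omega>))"
    using has_bochner_integral_simple_bochner_integrable integrable.intros by blast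
  then have "(\<integral>\<^sup>+\<omega>. ennreal (norm (s i \<omega>)) \<partial>P) < \<infinity>"
    unfolding integrable_iff_bounded by simp
  note s_fin = this
  have "(\<integral>\<^sup>+\<omega>. ennreal (norm (f \<omega>)) \<partial>P)
      \<le> (\<integral>\<^sup>+\<omega>. ennreal (norm (f \<omega> - s i \<omega>)) + ennreal (norm (s i \<omega>)) \<partial>P)"
  proof (rule nn_integral_mono)
    fix \<omega>
    have "norm (f \<omega>) \<le> norm (f \<omega> - s i \<omega>) + norm (s i \<omega>)"
      using norm_triangle_ineq[of "f \<omega> - s i \<omega>" "s i \<omega>"] by simp
    from ennreal_leI[OF this]
    show "ennreal (norm (f \<omega>)) \<le> ennreal (norm (f \<omega> - s i \<omega>)) + ennreal (norm (s i \<omega>))" by simp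
  qed
  also have "\<dots> = (\<integral>\<^sup>+\<omega>. ennreal (norm (f \<omega> - s i \<omega>)) \<partial>P) + (\<integral>\<^sup>+\<omega>. ennreal (norm (s i \<omega>)) \<partial>P)"
    by (rule nn_integral_add) auto
  also have "\<dots> < \<infinity>"
    using less_trans[OF i ennreal_one_less_top] s_fin by simp
  finally have "(\<integral>\<^sup>+\<omega>. ennreal (norm (f \<omega>)) \<partial>P) < \<infinity>" .
  then show ?thesis
    using strongly_measurable_norm[OF fm] unfolding integrable_iff_bounded by simp
qed

text \<open>For an indicator times a constant vector in place of \<open>x\<close>, the identity is the definition of the
  conditional expectation, tested with an inner product. It extends to simple functions by
  linearity and to bounded \<open>x\<close> by dominated convergence.\<close>

lemma is_cond_expectation_inner:
  fixes f g x :: "'w \<Rightarrow> 'u::real_inner"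
  assumes F: "subalgebra P F" and cond: "is_cond_expectation P F f g"
    and x: "strongly_measurable F x" and bound: "\<And>\<omega>. \<omega> \<in> space P \<Longrightarrow> norm (x \<omega>) \<le> b"
  shows "integrable P (\<lambda>\<omega>. x \<omega> \<bullet> f \<omega>)" "integrable P (\<lambda>\<omega>. x \<omega> \<bullet> g \<omega>)"
    "(\<integral>\<omega>. x \<omega> \<bullet> f \<omega> \<partial>P) = (\<integral>\<omega>. x \<omega> \<bullet> g \<omega> \<partial>P)"
proof -
  have spF: "space F = space P" using F by (simp add: subalgebra_def)
  have ce: "\<exists>I. has_strong_integral P (\<lambda>\<omega>. indicator A \<omega> *\<^sub>R f \<omega>) I \<and>
      has_strong_integral P (\<lambda>\<omega>. indicator A \<omega> *\<^sub>R g \<omega>) I" if "A \<in> sets F" for A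
    using cond that unfolding is_cond_expectation_def by blast
  obtain I where I: "has_strong_integral P (\<lambda>\<omega>. indicator (space F) \<omega> *\<^sub>R f \<omega>) I"
      "has_strong_integral P (\<lambda>\<omega>. indicator (space F) \<omega> *\<^sub>R g \<omega>) I"
    using ce[of "space F"] by auto
  have on_space: "strongly_measurable P h"
    if "strongly_measurable P (\<lambda>\<omega>. indicator (space F) \<omega> *\<^sub>R h \<omega>)" for h :: "'w \<Rightarrow> 'u"
    using that unfolding strongly_measurable_def by (simp add: spF)
  have fm: "strongly_measurable P f" and gm: "strongly_measurable P g"
    using I[unfolded has_strong_integral_def, THEN conjunct1, THEN on_space] .
  have nf: "integrable P (\<lambda>\<omega>. norm (f \<omega>))" and ng: "integrable P (\<lambda>\<omega>. norm (g \<omega>))"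
    using has_strong_integral_integrable_norm[OF I(1)] has_strong_integral_integrable_norm[OF I(2)]
    by (simp_all add: spF cong: Bochner_Integration.integrable_cong)
  obtain s where s: "\<And>i. simple_function F (s i)" "\<And>\<omega>. \<omega> \<in> space F \<Longrightarrow> (\<lambda>i. s i \<omega>) \<longlonglongrightarrow> x \<omega>"
    using x unfolding strongly_measurable_def by blast
  \<comment> \<open>Cutting off the approximants at \<open>b + 1\<close> keeps them dominated; since \<open>|x| \<le> b\<close>, the cut is
    eventually inactive at every point.\<close>
  define r where "r i \<omega> = (if norm (s i \<omega>) \<le> b + 1 then s i \<omega> else 0)" for i \<omega>
  have r_simple: "simple_function F (r i)" for i
    unfolding r_def using simple_function_compose1[OF s(1), of "\<lambda>y. if norm y \<le> b + 1 then y else 0"] .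
  have b0: "0 \<le> b + 1" if "\<omega> \<in> space P" for \<omega>
    using bound[OF that] norm_ge_zero[of "x \<omega>"] by linarith
  have r_bound: "norm (r i \<omega>) \<le> b + 1" if "\<omega> \<in> space P" for i \<omega>
    unfolding r_def using b0[OF that] by simp
  have r_lim: "(\<lambda>i. r i \<omega>) \<longlonglongrightarrow> x \<omega>" if "\<omega> \<in> space P" for \<omega>
  proof -
    have "(\<lambda>i. norm (s i \<omega>)) \<longlonglongrightarrow> norm (x \<omega>)" using s(2) that by (intro tendsto_norm) (simp add: spF)
    then have "\<forall>\<^sub>F i in sequentially. norm (s i \<omega>) < b + 1"
      using bound[OF that] by (intro order_tendstoD(2)) auto
    then have "\<forall>\<^sub>F i in sequentially. s i \<omega> = r i \<omega>"
      by eventually_elim (simp add: r_def)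
    moreover have "(\<lambda>i. s i \<omega>) \<longlonglongrightarrow> x \<omega>" using s(2) that by (simp add: spF)
    ultimately show ?thesis by (rule Lim_transform_eventually[rotated])
  qed
  have xm: "strongly_measurable P x" using F x by (rule strongly_measurable_subalgebra)
  have rm: "strongly_measurable P (r i)" for i
    using F strongly_measurable_simple[OF r_simple] by (rule strongly_measurable_subalgebra)
  have eq: "(\<integral>\<omega>. r i \<omega> \<bullet> f \<omega> \<partial>P) = (\<integral>\<omega>. r i \<omega> \<bullet> g \<omega> \<partial>P)" for i
  proof -
    let ?A = "\<lambda>c. {\<omega> \<in> space F. r i \<omega> = c}"
    have fin: "finite (r i ` space F)" using r_simple[of i] by (rule simple_functionD)
    have A: "?A c \<in> sets F" for c
    proof -
      have "?A c = r i -` {c} \<inter> space F" by auto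
      then show ?thesis using r_simple[of i] by (simp add: simple_functionD)
    qed
    have decomp: "(\<integral>\<omega>. r i \<omega> \<bullet> h \<omega> \<partial>P) = (\<integral>\<omega>. (\<Sum>c\<in>r i ` space F. c \<bullet> (indicator (?A c) \<omega> *\<^sub>R h \<omega>)) \<partial>P)" for h
    proof (rule Bochner_Integration.integral_cong[OF refl])
      fix \<omega> assume \<omega>: "\<omega> \<in> space P"
      have "(\<Sum>c\<in>r i ` space F. c \<bullet> (indicator (?A c) \<omega> *\<^sub>R h \<omega>))
          = (\<Sum>c\<in>r i ` space F. if r i \<omega> = c then c \<bullet> h \<omega> else 0)"
        by (intro sum.cong refl) (auto simp: \<omega> spF)
      also have "\<dots> = r i \<omega> \<bullet> h \<omega>"
        using fin \<omega> by (simp add: spF)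
      finally show "r i \<omega> \<bullet> h \<omega> = (\<Sum>c\<in>r i ` space F. c \<bullet> (indicator (?A c) \<omega> *\<^sub>R h \<omega>))" by simp
    qed
    have piece: "integrable P (\<lambda>\<omega>. c \<bullet> (indicator (?A c) \<omega> *\<^sub>R f \<omega>))"
      "integrable P (\<lambda>\<omega>. c \<bullet> (indicator (?A c) \<omega> *\<^sub>R g \<omega>))"
      "(\<integral>\<omega>. c \<bullet> (indicator (?A c) \<omega> *\<^sub>R f \<omega>) \<partial>P) = (\<integral>\<omega>. c \<bullet> (indicator (?A c) \<omega> *\<^sub>R g \<omega>) \<partial>P)" for c
    proof -
      obtain J where J: "has_strong_integral P (\<lambda>\<omega>. indicator (?A c) \<omega> *\<^sub>R f \<omega>) J"
          "has_strong_integral P (\<lambda>\<omega>. indicator (?A c) \<omega> *\<^sub>R g \<omega>) J"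
        using ce[OF A] by blast
      note Jc = has_strong_integral_linear[OF J(1) bounded_linear_inner_right[of c]]
        has_strong_integral_linear[OF J(2) bounded_linear_inner_right[of c]]
      show "integrable P (\<lambda>\<omega>. c \<bullet> (indicator (?A c) \<omega> *\<^sub>R f \<omega>))"
        using Jc(1) by (rule integrable.intros)
      show "integrable P (\<lambda>\<omega>. c \<bullet> (indicator (?A c) \<omega> *\<^sub>R g \<omega>))"
        using Jc(2) by (rule integrable.intros)
      show "(\<integral>\<omega>. c \<bullet> (indicator (?A c) \<omega> *\<^sub>R f \<omega>) \<partial>P) = (\<integral>\<omega>. c \<bullet> (indicator (?A c) \<omega> *\<^sub>R g \<omega>) \<partial>P)"
        unfolding has_bochner_integral_integral_eq[OF Jc(1)] has_bochner_integral_integral_eq[OF Jc(2)] ..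
    qed
    show ?thesis
      unfolding decomp Bochner_Integration.integral_sum[OF piece(1)] Bochner_Integration.integral_sum[OF piece(2)]
        piece(3) ..
  qed
  have dom: "integrable P (\<lambda>\<omega>. x \<omega> \<bullet> h \<omega>)" "(\<lambda>i. \<integral>\<omega>. r i \<omega> \<bullet> h \<omega> \<partial>P) \<longlonglongrightarrow> (\<integral>\<omega>. x \<omega> \<bullet> h \<omega> \<partial>P)"
    if hm: "strongly_measurable P h" and nh: "integrable P (\<lambda>\<omega>. norm (h \<omega>))" for h
  proof -
    have lim: "AE \<omega> in P. (\<lambda>i. r i \<omega> \<bullet> h \<omega>) \<longlonglongrightarrow> x \<omega> \<bullet> h \<omega>"
      by (intro AE_I2 tendsto_inner r_lim tendsto_const)
    have bd: "AE \<omega> in P. norm (r i \<omega> \<bullet> h \<omega>) \<le> (b + 1) * norm (h \<omega>)" for i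
    proof (rule AE_I2)
      fix \<omega> assume "\<omega> \<in> space P"
      have "norm (r i \<omega> \<bullet> h \<omega>) \<le> norm (r i \<omega>) * norm (h \<omega>)"
        by (simp add: Cauchy_Schwarz_ineq2)
      also have "\<dots> \<le> (b + 1) * norm (h \<omega>)"
        by (intro mult_right_mono r_bound \<open>\<omega> \<in> space P\<close> norm_ge_zero)
      finally show "norm (r i \<omega> \<bullet> h \<omega>) \<le> (b + 1) * norm (h \<omega>)" .
    qed
    note * = strongly_measurable_inner[OF xm hm] strongly_measurable_inner[OF rm hm]
      integrable_mult_right[OF nh, of "b + 1"] lim bd
    show "integrable P (\<lambda>\<omega>. x \<omega> \<bullet> h \<omega>)" using * by (rule integrable_dominated_convergence)
    show "(\<lambda>i. \<integral>\<omega>. r i \<omega> \<bullet> h \<omega> \<partial>P) \<longlonglongrightarrow> (\<integral>\<omega>. x \<omega> \<bullet> h \<omega> \<partial>P)"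
      using * by (rule integral_dominated_convergence)
  qed
  show "integrable P (\<lambda>\<omega>. x \<omega> \<bullet> f \<omega>)" "integrable P (\<lambda>\<omega>. x \<omega> \<bullet> g \<omega>)"
    using dom(1) fm nf gm ng by blast+
  show "(\<integral>\<omega>. x \<omega> \<bullet> f \<omega> \<partial>P) = (\<integral>\<omega>. x \<omega> \<bullet> g \<omega> \<partial>P)"
    using LIMSEQ_unique[OF dom(2)[OF fm nf]] dom(2)[OF gm ng] unfolding eq by blast
qed

section \<open>Iterates, samples and independence\<close>

text \<open>Runs of finite and of infinite length are covered by an index set \<open>I\<close> that is an initial segment
  of the positive integers.\<close>

locale projected_sg = prob_space P
  for P :: "'w measure" +
  fixes S :: "'x measure" and \<xi> :: "'w \<Rightarrow> 'x" and U :: "'u::{real_inner, complete_space} set"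
    and G :: "'u \<Rightarrow> 'x \<Rightarrow> 'u" and M :: real and u1 :: 'u and I :: "nat set" and t :: "nat \<Rightarrow> real"
    and \<zeta> :: "nat \<Rightarrow> 'w \<Rightarrow> 'x" and us :: "nat \<Rightarrow> 'w \<Rightarrow> 'u"
    and dj :: "'u \<Rightarrow> 'u" and F :: "nat \<Rightarrow> 'w measure" and EG :: "nat \<Rightarrow> 'w \<Rightarrow> 'u"
  assumes closed_U: "closed U" and convex_U: "convex U"
    and \<xi>_meas: "\<xi> \<in> P \<rightarrow>\<^sub>M S"
    and G_meas: "(\<lambda>(v, x). G v x) \<in> borel \<Otimes>\<^sub>M S \<rightarrow>\<^sub>M borel"
    and second_moment: "\<And>v. v \<in> U \<Longrightarrow> (\<integral>\<^sup>+\<omega>. ennreal ((norm (G v (\<xi> \<omega>)))\<^sup>2) \<partial>P) \<le> ennreal M"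
    and M_pos: "0 < M"
    and run: "projected_stochastic_gradient P S \<xi> U G u1 I t \<zeta> us"
    and sga: "stochastic_gradient_assumption P dj G I \<zeta> us F EG"
    and initial_segment: "\<And>n. n \<in> I \<Longrightarrow> {1..n} \<subseteq> I"
begin

abbreviation sg :: "nat \<Rightarrow> 'w \<Rightarrow> 'u" where
  "sg n \<omega> \<equiv> G (us n \<omega>) (\<zeta> n \<omega>)"

text \<open>For \<open>n = 1\<close> the tuple is empty and the sigma algebra is trivial, in accordance with the
  deterministic starting point.\<close>

definition past :: "nat \<Rightarrow> 'w measure" where
  "past n = vimage_algebra (space P) (\<lambda>\<omega>. \<lambda>k\<in>{1..<n}. \<zeta> k \<omega>) (\<Pi>\<^sub>M k\<in>{1..<n}. S)"

lemma U_ne: "U \<noteq> {}" and us_1: "\<omega> \<in> space P \<Longrightarrow> us 1 \<omega> = u1" and u1_in: "u1 \<in> U"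
  using run unfolding projected_stochastic_gradient_def by auto

lemma sample: "n \<in> I \<Longrightarrow> \<zeta> n \<in> P \<rightarrow>\<^sub>M S"
  and sample_distr: "n \<in> I \<Longrightarrow> distr P S (\<zeta> n) = distr P S \<xi>"
  and t_pos: "n \<in> I \<Longrightarrow> 0 < t n"
  and us_Suc: "n \<in> I \<Longrightarrow> \<omega> \<in> space P \<Longrightarrow> us (Suc n) \<omega> = metric_projection U (us n \<omega> - t n *\<^sub>R sg n \<omega>)"
  using run unfolding projected_stochastic_gradient_def by auto

lemma sample_indep: "n \<in> I \<Longrightarrow> indep_set (sets (vimage_algebra (space P) (\<zeta> n) S)) (sets (past n))"
  using run unfolding projected_stochastic_gradient_def past_def by auto

lemma F_subalgebra: "n \<in> I \<Longrightarrow> subalgebra P (F n)"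
  and cond_exp: "n \<in> I \<Longrightarrow> is_cond_expectation P (F n) (sg n) (EG n)"
  and us_F: "n \<in> I \<Longrightarrow> strongly_measurable (F n) (us n)"
  and err_F: "n \<in> I \<Longrightarrow> strongly_measurable (F n) (gradient_error dj us EG n)"
  using sga unfolding stochastic_gradient_assumption_def by auto

lemma us_strong: "n \<in> I \<Longrightarrow> strongly_measurable P (us n)"
  using strongly_measurable_subalgebra[OF F_subalgebra us_F] .

lemma sg_strong:
  assumes "n \<in> I"
  shows "strongly_measurable P (sg n)"
proof -
  have "space P \<in> sets (F n)"
    using F_subalgebra[OF assms] sets.top[of "F n"] by (simp add: subalgebra_def)
  then have "strongly_measurable P (\<lambda>\<omega>. indicator (space P) \<omega> *\<^sub>R sg n \<omega>)"
    using cond_exp[OF assms] unfolding is_cond_expectation_def has_strong_integral_def by blast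
  then show ?thesis unfolding strongly_measurable_def by simp
qed

lemma us_in_U:
  assumes "1 \<le> n" "{1..<n} \<subseteq> I" "\<omega> \<in> space P"
  shows "us n \<omega> \<in> U"
proof (cases "n = 1")
  case True
  then show ?thesis using us_1 u1_in assms(3) by simp
next
  case False
  then obtain m where m: "n = Suc m" "1 \<le> m"
    using assms(1) by (cases n) auto
  then have mI: "m \<in> I" using assms(2) by auto
  show ?thesis
    unfolding m(1) us_Suc[OF mI assms(3)]
    using metric_projection_nearest[OF U_ne closed_U convex_U] by blast
qed

lemma space_past: "space (past n) = space P"
  by (simp add: past_def)

lemma sample_past:
  assumes "{1..<n} \<subseteq> I" "k \<in> {1..<n}"
  shows "\<zeta> k \<in> past n \<rightarrow>\<^sub>M S"
proof -
  have "(\<lambda>\<omega>. \<lambda>k\<in>{1..<n}. \<zeta> k \<omega>) \<in> past n \<rightarrow>\<^sub>M (\<Pi>\<^sub>M k\<in>{1..<n}. S)"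
    unfolding past_def
    by (rule measurable_vimage_algebra1)
      (use assms(1) measurable_space[OF sample] in \<open>auto simp: space_PiM PiE_iff\<close>)
  from measurable_compose[OF this measurable_component_singleton[OF assms(2)]]
  show ?thesis using assms(2) by simp
qed

lemma past_mono:
  assumes "{1..<Suc n} \<subseteq> I" "f \<in> past n \<rightarrow>\<^sub>M N"
  shows "f \<in> past (Suc n) \<rightarrow>\<^sub>M N"
proof -
  have "(\<lambda>\<omega>. \<omega>) \<in> past (Suc n) \<rightarrow>\<^sub>M past n"
    unfolding past_def[of n]
  proof (rule measurable_vimage_algebra2)
    show "(\<lambda>\<omega>. \<omega>) \<in> space (past (Suc n)) \<rightarrow> space P" by (simp add: space_past)
    show "(\<lambda>\<omega>. \<lambda>k\<in>{1..<n}. \<zeta> k \<omega>) \<in> past (Suc n) \<rightarrow>\<^sub>M (\<Pi>\<^sub>M k\<in>{1..<n}. S)"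
      by (intro measurable_restrict sample_past assms(1)) auto
  qed
  from measurable_compose[OF this assms(2)] show ?thesis .
qed

text \<open>Two notions of measurability interact. With respect to \<open>N\<close>, the stochastic gradient is only known
  to be Borel measurable, as a composition with the jointly measurable \<open>G\<close>, which does not make the
  difference \<open>u\<^sub>n - t\<^sub>n G(u\<^sub>n, \<xi>\<^sub>n)\<close> measurable. Strong measurability holds with respect to other sigma
  algebras, but it makes the ranges separable, and this does not refer to any sigma algebra.\<close>

lemma step_measurable:
  assumes n: "n \<in> I" and sp: "space N = space P" and us: "us n \<in> borel_measurable N" and \<zeta>: "\<zeta> n \<in> N \<rightarrow>\<^sub>M S"
  shows "us (Suc n) \<in> borel_measurable N"
proof -
  have sgm: "sg n \<in> borel_measurable N"
    using measurable_compose[OF measurable_Pair[OF us \<zeta>] G_meas] by simp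
  obtain C where C: "countable C" "us n ` space P \<subseteq> closure C"
    using strongly_measurable_separable_range[OF us_strong[OF n]] .
  obtain D where D: "countable D" "sg n ` space P \<subseteq> closure D"
    using strongly_measurable_separable_range[OF sg_strong[OF n]] .
  have "(\<lambda>\<omega>. (us n \<omega>, sg n \<omega>)) \<in> borel_measurable N"
    using borel_measurable_Pair_separable[OF us sgm C(1) _ D(1)] C(2) D(2) sp by simp
  then have "(\<lambda>\<omega>. metric_projection U (fst (us n \<omega>, sg n \<omega>) - t n *\<^sub>R snd (us n \<omega>, sg n \<omega>))) \<in> borel_measurable N"
    by (rule borel_measurable_continuous_comp)
      (intro continuous_on_compose2[OF continuous_on_metric_projection[OF U_ne closed_U convex_U]]
        continuous_intros subset_UNIV)
  then show ?thesis
    by (rule measurable_cong[THEN iffD1, rotated]) (simp add: us_Suc n sp)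
qed

text \<open>The iterate \<open>us n\<close> is a function of the samples \<open>\<zeta> 1, \<dots>, \<zeta> (n - 1)\<close>, which makes it independent
  of the sample \<open>\<zeta> n\<close>.\<close>

lemma us_past:
  assumes "1 \<le> n" "{1..<n} \<subseteq> I"
  shows "us n \<in> borel_measurable (past n)"
  using assms
proof (induction n rule: dec_induct)
  case base
  have "(\<lambda>_. u1) \<in> borel_measurable (past 1)" by simp
  then show ?case
    by (rule measurable_cong[THEN iffD1, rotated]) (use us_1 in \<open>simp add: space_past\<close>)
next
  case (step n)
  have n: "n \<in> I" "{1..<n} \<subseteq> I" using step by auto
  show ?case
    using step n by (intro step_measurable space_past past_mono sample_past) auto
qed

lemma past_subalgebra:
  assumes "{1..<n} \<subseteq> I"
  shows "subalgebra P (past n)"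
proof -
  have "(\<lambda>\<omega>. \<lambda>k\<in>{1..<n}. \<zeta> k \<omega>) \<in> P \<rightarrow>\<^sub>M (\<Pi>\<^sub>M k\<in>{1..<n}. S)"
    using assms by (intro measurable_restrict sample) auto
  then have "(\<lambda>\<omega>. \<omega>) \<in> P \<rightarrow>\<^sub>M past n"
    unfolding past_def by (intro measurable_vimage_algebra2) auto
  note id = this
  have "A \<in> sets P" if "A \<in> sets (past n)" for A
  proof -
    have "(\<lambda>\<omega>. \<omega>) -` A \<inter> space P = A"
      using sets.sets_into_space[OF that] by (auto simp: space_past)
    with measurable_sets[OF id that] show ?thesis by simp
  qed
  then show ?thesis unfolding subalgebra_def by (auto simp: space_past)
qed

lemma us_borel:
  assumes "1 \<le> n" "{1..<n} \<subseteq> I"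
  shows "us n \<in> borel_measurable P"
  using measurable_from_subalg[OF past_subalgebra us_past] assms by blast

lemma joint_distribution:
  assumes n: "n \<in> I" "1 \<le> n"
  shows "distr P borel (us n) \<Otimes>\<^sub>M distr P S (\<zeta> n) = distr P (borel \<Otimes>\<^sub>M S) (\<lambda>\<omega>. (us n \<omega>, \<zeta> n \<omega>))"
proof (rule pair_measure_eqI)
  have I: "{1..<n} \<subseteq> I" using initial_segment[OF n(1)] by auto
  note [measurable] = us_borel[OF n(2) I] sample[OF n(1)]
  show "sigma_finite_measure (distr P borel (us n))" "sigma_finite_measure (distr P S (\<zeta> n))"
    by (intro prob_space_imp_sigma_finite prob_space_distr; measurable)+
  show "sets (distr P borel (us n) \<Otimes>\<^sub>M distr P S (\<zeta> n)) = sets (distr P (borel \<Otimes>\<^sub>M S) (\<lambda>\<omega>. (us n \<omega>, \<zeta> n \<omega>)))"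
    by (simp cong: sets_pair_measure_cong)
  fix A B assume "A \<in> sets (distr P borel (us n))" "B \<in> sets (distr P S (\<zeta> n))"
  then have A [measurable]: "A \<in> sets borel" and B [measurable]: "B \<in> sets S" by auto
  have "\<zeta> n -` B \<inter> space P \<in> sets (vimage_algebra (space P) (\<zeta> n) S)"
    using B by (rule in_vimage_algebra)
  moreover have "us n -` A \<inter> space P \<in> sets (past n)"
    using measurable_sets[OF us_past[OF n(2) I] A] by (simp add: space_past)
  ultimately have "prob ((\<zeta> n -` B \<inter> space P) \<inter> (us n -` A \<inter> space P))
      = prob (\<zeta> n -` B \<inter> space P) * prob (us n -` A \<inter> space P)"
    by (rule indep_setD[OF sample_indep[OF n(1)]])
  moreover have "(\<lambda>\<omega>. (us n \<omega>, \<zeta> n \<omega>)) -` (A \<times> B) \<inter> space P = (\<zeta> n -` B \<inter> space P) \<inter> (us n -` A \<inter> space P)"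
    by auto
  ultimately show "emeasure (distr P borel (us n)) A * emeasure (distr P S (\<zeta> n)) B
      = emeasure (distr P (borel \<Otimes>\<^sub>M S) (\<lambda>\<omega>. (us n \<omega>, \<zeta> n \<omega>))) (A \<times> B)"
    by (simp add: emeasure_distr emeasure_eq_measure ennreal_mult[symmetric] mult.commute)
qed

text \<open>The moment bound is assumed at fixed points \<open>v\<close> only. Since \<open>us n\<close> and \<open>\<zeta> n\<close> are independent,
  Fubini's theorem reduces the bound at the random point \<open>us n\<close> to that case.\<close>

lemma second_moment_sg:
  assumes n: "n \<in> I" "1 \<le> n"
  shows "(\<integral>\<^sup>+\<omega>. ennreal ((norm (sg n \<omega>))\<^sup>2) \<partial>P) \<le> ennreal M"
proof -
  have I: "{1..<n} \<subseteq> I" using initial_segment[OF n(1)] by auto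
  note [measurable] = us_borel[OF n(2) I] sample[OF n(1)] G_meas \<xi>_meas
  define f where "f = (\<lambda>p. ennreal ((norm (case p of (v, x) \<Rightarrow> G v x))\<^sup>2))"
  have f [measurable]: "f \<in> borel_measurable (borel \<Otimes>\<^sub>M S)"
    unfolding f_def
    by (intro measurable_compose[OF _ measurable_ennreal] borel_measurable_power
      borel_measurable_continuous_comp[OF G_meas]) (intro continuous_intros)
  interpret Y: prob_space "distr P S (\<zeta> n)" by (rule prob_space_distr) measurable
  have "(\<integral>\<^sup>+\<omega>. ennreal ((norm (sg n \<omega>))\<^sup>2) \<partial>P) = (\<integral>\<^sup>+\<omega>. f (us n \<omega>, \<zeta> n \<omega>) \<partial>P)"
    by (simp add: f_def)
  also have "\<dots> = (\<integral>\<^sup>+p. f p \<partial>distr P (borel \<Otimes>\<^sub>M S) (\<lambda>\<omega>. (us n \<omega>, \<zeta> n \<omega>)))"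
    by (rule nn_integral_distr[symmetric]) measurable
  also have "\<dots> = (\<integral>\<^sup>+p. f p \<partial>(distr P borel (us n) \<Otimes>\<^sub>M distr P S (\<zeta> n)))"
    by (simp add: joint_distribution[OF n])
  also have "\<dots> = (\<integral>\<^sup>+v. (\<integral>\<^sup>+x. f (v, x) \<partial>distr P S (\<zeta> n)) \<partial>distr P borel (us n))"
    by (rule Y.nn_integral_fst[symmetric]) (simp cong: measurable_cong_sets sets_pair_measure_cong)
  also have "\<dots> = (\<integral>\<^sup>+\<omega>. (\<integral>\<^sup>+x. f (us n \<omega>, x) \<partial>distr P S (\<zeta> n)) \<partial>P)"
    by (rule nn_integral_distr) (auto intro!: Y.borel_measurable_nn_integral_fst
      simp: cong: measurable_cong_sets sets_pair_measure_cong)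
  also have "\<dots> \<le> (\<integral>\<^sup>+\<omega>. ennreal M \<partial>P)"
  proof (rule nn_integral_mono)
    fix \<omega> assume "\<omega> \<in> space P"
    then have U: "us n \<omega> \<in> U" by (intro us_in_U n(2) I)
    have "(\<integral>\<^sup>+x. f (us n \<omega>, x) \<partial>distr P S (\<zeta> n)) = (\<integral>\<^sup>+\<omega>'. f (us n \<omega>, \<xi> \<omega>') \<partial>P)"
      unfolding sample_distr[OF n(1)] by (rule nn_integral_distr) measurable
    also have "\<dots> \<le> ennreal M" using second_moment[OF U] by (simp add: f_def)
    finally show "(\<integral>\<^sup>+x. f (us n \<omega>, x) \<partial>distr P S (\<zeta> n)) \<le> ennreal M" .
  qed
  also have "\<dots> = ennreal M" by (simp add: emeasure_space_1)
  finally show ?thesis .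
qed

lemma expected_square_sg:
  assumes n: "n \<in> I" "1 \<le> n"
  shows "integrable P (\<lambda>\<omega>. (norm (sg n \<omega>))\<^sup>2)" "expectation (\<lambda>\<omega>. (norm (sg n \<omega>))\<^sup>2) \<le> M"
proof -
  have meas: "(\<lambda>\<omega>. (norm (sg n \<omega>))\<^sup>2) \<in> borel_measurable P"
    using strongly_measurable_norm[OF sg_strong[OF n(1)]] by (rule borel_measurable_power)
  have le: "(\<integral>\<^sup>+\<omega>. ennreal ((norm (sg n \<omega>))\<^sup>2) \<partial>P) \<le> ennreal M" by (rule second_moment_sg[OF n])
  show int: "integrable P (\<lambda>\<omega>. (norm (sg n \<omega>))\<^sup>2)"
    using meas le by (intro integrableI_bounded) (auto intro: le_less_trans)
  show "expectation (\<lambda>\<omega>. (norm (sg n \<omega>))\<^sup>2) \<le> M"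
    using le nn_integral_eq_integral[OF int] M_pos by simp
qed

text \<open>The biases have a finite supremum over the iterations, and the essential supremum of a nonnegative
  function over a probability space is nonnegative; so each bias can be treated as a real number.\<close>

lemma bias_finite:
  assumes n: "n \<in> I"
  shows "bias P dj us EG n = ereal (real_of_ereal (bias P dj us EG n))"
    and "0 \<le> real_of_ereal (bias P dj us EG n)"
    and "AE \<omega> in P. norm (gradient_error dj us EG n \<omega>) \<le> real_of_ereal (bias P dj us EG n)"
proof -
  have AE: "AE \<omega> in P. ereal (norm (gradient_error dj us EG n \<omega>)) \<le> bias P dj us EG n"
    unfolding bias_def by (rule esssup_AE)
  have "bias P dj us EG n \<le> (SUP n\<in>I. bias P dj us EG n)" using n by (rule SUP_upper)
  then have fin: "bias P dj us EG n < \<infinity>"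
    using sga unfolding stochastic_gradient_assumption_def by (auto intro: le_less_trans)
  have "AE \<omega> in P. 0 \<le> bias P dj us EG n"
    using AE by eventually_elim (auto intro: order_trans[rotated])
  then have pos: "0 \<le> bias P dj us EG n" by simp
  show eq: "bias P dj us EG n = ereal (real_of_ereal (bias P dj us EG n))"
    using fin pos by (cases "bias P dj us EG n") auto
  show "0 \<le> real_of_ereal (bias P dj us EG n)" using pos by (rule real_of_ereal_pos)
  show "AE \<omega> in P. norm (gradient_error dj us EG n \<omega>) \<le> real_of_ereal (bias P dj us EG n)"
    using AE by (subst (asm) eq) simp
qed

end

section \<open>Descent in expectation\<close>

text \<open>Convexity ties the vector field \<open>dj\<close> to \<open>j\<close> through the gradient inequality, which is the form in
  which the descent estimate uses it.\<close>

locale convex_projected_sg = projected_sg +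
  fixes j :: "'c \<Rightarrow> real" and u :: 'c and b :: real
  assumes j_convex: "convex_on U j" and j_cont: "continuous_on U j"
    and j_grad: "\<And>v w. v \<in> U \<Longrightarrow> w \<in> U \<Longrightarrow> j v - j w \<le> (v - w) \<bullet> dj v"
    and u_in: "u \<in> U" and u_min: "\<And>v. v \<in> U \<Longrightarrow> j u \<le> j v"
    and diameter: "\<And>v w. v \<in> U \<Longrightarrow> w \<in> U \<Longrightarrow> norm (v - w) \<le> b"
begin

abbreviation K :: "nat \<Rightarrow> real" where
  "K n \<equiv> real_of_ereal (bias P dj us EG n)"

abbreviation gap :: "nat \<Rightarrow> real" where
  "gap n \<equiv> expectation (\<lambda>\<omega>. j (us n \<omega>) - j u)"

abbreviation sqdist :: "nat \<Rightarrow> real" where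
  "sqdist n \<equiv> expectation (\<lambda>\<omega>. (norm (us n \<omega> - u))\<^sup>2)"

lemma b_nonneg: "0 \<le> b"
  using diameter[OF u_in u_in] by simp

lemma sqdist_integrable:
  assumes "1 \<le> n" "{1..<n} \<subseteq> I"
  shows "integrable P (\<lambda>\<omega>. (norm (us n \<omega> - u))\<^sup>2)"
proof (rule integrable_const_bound[of _ "b\<^sup>2"])
  show "(\<lambda>\<omega>. (norm (us n \<omega> - u))\<^sup>2) \<in> borel_measurable P"
    by (rule borel_measurable_continuous_comp[OF us_borel[OF assms]]) (intro continuous_intros)
  show "AE \<omega> in P. norm ((norm (us n \<omega> - u))\<^sup>2) \<le> b\<^sup>2"
  proof (rule AE_I2)
    fix \<omega> assume "\<omega> \<in> space P"
    then have "norm (us n \<omega> - u) \<le> b" using diameter us_in_U assms u_in by blast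
    then show "norm ((norm (us n \<omega> - u))\<^sup>2) \<le> b\<^sup>2" by (simp add: power_mono)
  qed
qed

lemma sqdist_le:
  assumes "1 \<le> n" "{1..<n} \<subseteq> I"
  shows "sqdist n \<le> b\<^sup>2"
proof -
  have "sqdist n \<le> expectation (\<lambda>_. b\<^sup>2)"
  proof (rule integral_mono[OF sqdist_integrable[OF assms]])
    fix \<omega> assume "\<omega> \<in> space P"
    then have "norm (us n \<omega> - u) \<le> b" using diameter us_in_U assms u_in by blast
    then show "(norm (us n \<omega> - u))\<^sup>2 \<le> b\<^sup>2" by (simp add: power_mono)
  qed simp
  then show ?thesis by (simp add: prob_space)
qed

lemma j_borel:
  assumes "v \<in> borel_measurable P" "\<And>\<omega>. \<omega> \<in> space P \<Longrightarrow> v \<omega> \<in> U"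
  shows "(\<lambda>\<omega>. j (v \<omega>)) \<in> borel_measurable P"
proof -
  have "v \<in> P \<rightarrow>\<^sub>M restrict_space borel U"
    using assms by (intro measurable_restrict_space2) auto
  from measurable_compose[OF this borel_measurable_continuous_on_restrict[OF j_cont]]
  show ?thesis .
qed

text \<open>The gap lies between 0 and an integrable function, the inner product of \<open>us n - u\<close> with the
  conditional expectation plus \<open>b\<close> times the bias. This gives its integrability, and in expectation
  the conditional expectation gives way to the stochastic gradient itself, which the expansion of the
  squared distance after one step controls.\<close>

lemma gap_step:
  assumes n: "n \<in> I" "1 \<le> n"
  shows "integrable P (\<lambda>\<omega>. j (us n \<omega>) - j u)"
    and "t n * gap n \<le> (sqdist n - sqdist (Suc n)) / 2 + M / 2 * (t n)\<^sup>2 + b * (t n * K n)"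
proof -
  have I: "{1..<n} \<subseteq> I" "{1..<Suc n} \<subseteq> I" using initial_segment[OF n(1)] by auto
  have x_bound: "norm (us n \<omega> - u) \<le> b" and xU: "us n \<omega> \<in> U" if "\<omega> \<in> space P" for \<omega>
    using that us_in_U[OF n(2) I(1)] u_in diameter by blast+
  have xF: "strongly_measurable (F n) (\<lambda>\<omega>. us n \<omega> - u)"
    by (intro strongly_measurable_diff us_F n strongly_measurable_const)
  note ce = is_cond_expectation_inner[OF F_subalgebra[OF n(1)] cond_exp[OF n(1)] xF x_bound]
  let ?x = "\<lambda>\<omega>. us n \<omega> - u"
  have gap_le: "AE \<omega> in P. j (us n \<omega>) - j u \<le> ?x \<omega> \<bullet> EG n \<omega> + b * K n"
    using bias_finite(3)[OF n(1)] AE_space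
  proof eventually_elim
    case (elim \<omega>)
    have "- (?x \<omega> \<bullet> gradient_error dj us EG n \<omega>) \<le> norm (?x \<omega>) * norm (gradient_error dj us EG n \<omega>)"
      using Cauchy_Schwarz_ineq2[of "?x \<omega>" "gradient_error dj us EG n \<omega>"] by linarith
    also have "\<dots> \<le> b * K n"
      using x_bound[OF elim(2)] elim(1) b_nonneg by (intro mult_mono) auto
    finally show ?case
      using j_grad[OF xU[OF elim(2)] u_in] by (simp add: gradient_error_def inner_diff_right)
  qed
  have rhs_int: "integrable P (\<lambda>\<omega>. ?x \<omega> \<bullet> EG n \<omega> + b * K n)"
    using ce(2) by simp
  show int: "integrable P (\<lambda>\<omega>. j (us n \<omega>) - j u)"
  proof (rule Bochner_Integration.integrable_bound[OF rhs_int])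
    show "(\<lambda>\<omega>. j (us n \<omega>) - j u) \<in> borel_measurable P"
      using j_borel[OF us_borel[OF n(2) I(1)] xU] by simp
    show "AE \<omega> in P. norm (j (us n \<omega>) - j u) \<le> norm (?x \<omega> \<bullet> EG n \<omega> + b * K n)"
      using gap_le AE_space by eventually_elim (use u_min xU in force)
  qed
  have 1: "gap n \<le> expectation (\<lambda>\<omega>. ?x \<omega> \<bullet> sg n \<omega>) + b * K n"
  proof -
    have "gap n \<le> expectation (\<lambda>\<omega>. ?x \<omega> \<bullet> EG n \<omega> + b * K n)"
      using gap_le by (rule integral_mono_AE[OF int rhs_int])
    also have "\<dots> = expectation (\<lambda>\<omega>. ?x \<omega> \<bullet> EG n \<omega>) + b * K n"
      using ce(2) by (simp add: prob_space)
    finally show ?thesis using ce(3) by simp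
  qed
  have 2: "sqdist (Suc n) \<le> sqdist n - 2 * t n * expectation (\<lambda>\<omega>. ?x \<omega> \<bullet> sg n \<omega>) + (t n)\<^sup>2 * M"
  proof -
    have "sqdist (Suc n) \<le> expectation (\<lambda>\<omega>. (norm (?x \<omega>))\<^sup>2 - 2 * t n * (?x \<omega> \<bullet> sg n \<omega>) + (t n)\<^sup>2 * (norm (sg n \<omega>))\<^sup>2)"
    proof (rule integral_mono)
      show "integrable P (\<lambda>\<omega>. (norm (us (Suc n) \<omega> - u))\<^sup>2)"
        using I(2) by (intro sqdist_integrable) auto
      show "integrable P (\<lambda>\<omega>. (norm (?x \<omega>))\<^sup>2 - 2 * t n * (?x \<omega> \<bullet> sg n \<omega>) + (t n)\<^sup>2 * (norm (sg n \<omega>))\<^sup>2)"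
        using sqdist_integrable[OF n(2) I(1)] ce(1) expected_square_sg(1)[OF n]
        by (intro Bochner_Integration.integrable_add Bochner_Integration.integrable_diff integrable_mult_right) auto
      fix \<omega> assume "\<omega> \<in> space P"
      have "norm (us (Suc n) \<omega> - u) \<le> norm ((us n \<omega> - t n *\<^sub>R sg n \<omega>) - u)"
        unfolding us_Suc[OF n(1) \<open>\<omega> \<in> space P\<close>]
        by (rule metric_projection_dist_le[OF closed_U convex_U u_in])
      then have "(norm (us (Suc n) \<omega> - u))\<^sup>2 \<le> (norm (?x \<omega> - t n *\<^sub>R sg n \<omega>))\<^sup>2"
        by (intro power_mono) (simp_all add: algebra_simps)
      also have "\<dots> = (norm (?x \<omega>))\<^sup>2 - 2 * t n * (?x \<omega> \<bullet> sg n \<omega>) + (t n)\<^sup>2 * (norm (sg n \<omega>))\<^sup>2"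
        unfolding power2_norm_eq_inner by (simp add: inner_diff inner_commute power2_eq_square algebra_simps)
      finally show "(norm (us (Suc n) \<omega> - u))\<^sup>2 \<le> \<dots>" .
    qed
    also have "\<dots> = sqdist n - 2 * t n * expectation (\<lambda>\<omega>. ?x \<omega> \<bullet> sg n \<omega>) + (t n)\<^sup>2 * expectation (\<lambda>\<omega>. (norm (sg n \<omega>))\<^sup>2)"
      using sqdist_integrable[OF n(2) I(1)] ce(1) expected_square_sg(1)[OF n] by simp
    also have "\<dots> \<le> sqdist n - 2 * t n * expectation (\<lambda>\<omega>. ?x \<omega> \<bullet> sg n \<omega>) + (t n)\<^sup>2 * M"
      using expected_square_sg(2)[OF n] by (intro add_left_mono mult_left_mono) auto
    finally show ?thesis .
  qed
  have "t n * gap n \<le> t n * expectation (\<lambda>\<omega>. ?x \<omega> \<bullet> sg n \<omega>) + b * (t n * K n)"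
    using mult_left_mono[OF 1, of "t n"] t_pos[OF n(1)] by (simp add: distrib_left mult.left_commute)
  moreover have "sqdist (Suc n) \<le> sqdist n - 2 * (t n * expectation (\<lambda>\<omega>. ?x \<omega> \<bullet> sg n \<omega>)) + M * (t n)\<^sup>2"
    using 2 by (simp only: mult.assoc mult.commute[of _ M])
  ultimately show "t n * gap n \<le> (sqdist n - sqdist (Suc n)) / 2 + M / 2 * (t n)\<^sup>2 + b * (t n * K n)"
    by argo
qed

text \<open>The squared distances telescope; the first one is at most \<open>b\<^sup>2\<close> and the last one nonnegative.\<close>

lemma weighted_gap_sum:
  assumes "1 \<le> i" "i \<le> N" "N \<in> I"
  shows "(\<Sum>n=i..N. t n * gap n) \<le> b\<^sup>2 / 2 + M / 2 * (\<Sum>n=i..N. (t n)\<^sup>2) + b * (\<Sum>n=i..N. t n * K n)"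
proof -
  have I: "n \<in> I" if "n \<in> {i..N}" for n using initial_segment[OF assms(3)] assms(1) that by auto
  have "(\<Sum>n=i..N. t n * gap n)
      \<le> (\<Sum>n=i..N. (sqdist n - sqdist (Suc n)) / 2 + M / 2 * (t n)\<^sup>2 + b * (t n * K n))"
    using I assms(1) by (intro sum_mono gap_step(2)) auto
  also have "\<dots> = (\<Sum>n=i..N. sqdist n - sqdist (Suc n)) / 2 + M / 2 * (\<Sum>n=i..N. (t n)\<^sup>2) + b * (\<Sum>n=i..N. t n * K n)"
    by (simp add: sum.distrib sum_distrib_left sum_divide_distrib)
  also have "(\<Sum>n=i..N. sqdist n - sqdist (Suc n)) = sqdist i - sqdist (Suc N)"
    using sum_Suc_diff[of i "Suc N" "\<lambda>n. - sqdist n"] assms(2) by simp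
  also have "\<dots> \<le> b\<^sup>2"
  proof -
    have "{1..<i} \<subseteq> I" using initial_segment[OF assms(3)] assms(2) by auto
    moreover have "0 \<le> sqdist (Suc N)" by simp
    ultimately show ?thesis using sqdist_le[OF assms(1)] by linarith
  qed
  finally show ?thesis by simp
qed

text \<open>The averaging weights are proportional to the step sizes, so Jensen's inequality bounds the gap of
  the average by the weighted sum of the gaps divided by the sum of the step sizes.\<close>

lemma averaged_gap:
  assumes i: "1 \<le> i" "i \<le> N" "N \<in> I"
  shows "integrable P (\<lambda>\<omega>. j (averaged_iterate t us i N \<omega>) - j u)"
    and "0 \<le> expectation (\<lambda>\<omega>. j (averaged_iterate t us i N \<omega>) - j u)"
    and "(\<Sum>n=i..N. t n) * expectation (\<lambda>\<omega>. j (averaged_iterate t us i N \<omega>) - j u)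
      \<le> b\<^sup>2 / 2 + M / 2 * (\<Sum>n=i..N. (t n)\<^sup>2) + b * (\<Sum>n=i..N. t n * K n)"
proof -
  have I: "n \<in> I" "1 \<le> n" if "n \<in> {i..N}" for n using initial_segment[OF i(3)] i(1) that by auto
  let ?T = "\<Sum>n=i..N. t n" and ?a = "averaged_iterate t us i N"
  have T: "0 < ?T" using i(2) I t_pos by (intro sum_pos) auto
  define c where "c n = t n / ?T" for n
  have c: "(\<Sum>n=i..N. c n) = 1" "\<And>n. n \<in> {i..N} \<Longrightarrow> 0 \<le> c n"
    using T I t_pos by (auto simp: c_def sum_divide_distrib[symmetric] less_imp_le)
  have a_eq: "?a \<omega> = (\<Sum>n=i..N. c n *\<^sub>R us n \<omega>)" for \<omega>
    by (simp add: averaged_iterate_def c_def)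
  have usU: "us n \<omega> \<in> U" if "n \<in> {i..N}" "\<omega> \<in> space P" for n \<omega>
  proof (rule us_in_U)
    show "{1..<n} \<subseteq> I" using initial_segment[OF I(1)[OF that(1)]] by auto
  qed (use that I in auto)
  have aU: "?a \<omega> \<in> U" if "\<omega> \<in> space P" for \<omega>
    unfolding a_eq by (rule convex_sum[OF _ convex_U c]) (use usU that in auto)
  have a_meas: "?a \<in> borel_measurable P"
    unfolding a_eq[abs_def]
    by (intro strongly_measurable_borel strongly_measurable_sum strongly_measurable_scaleR us_strong I)
  have int: "integrable P (\<lambda>\<omega>. j (us n \<omega>) - j u)" if "n \<in> {i..N}" for n
    using I[OF that] by (intro gap_step(1))
  have jensen: "j (?a \<omega>) - j u \<le> (\<Sum>n=i..N. c n * (j (us n \<omega>) - j u))" if "\<omega> \<in> space P" for \<omega>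
  proof -
    have "j (?a \<omega>) \<le> (\<Sum>n=i..N. c n * j (us n \<omega>))"
      unfolding a_eq by (rule convex_on_sum[OF _ _ j_convex c]) (use i usU that in auto)
    moreover have "(\<Sum>n=i..N. c n * (j (us n \<omega>) - j u)) = (\<Sum>n=i..N. c n * j (us n \<omega>)) - j u"
      using c(1) by (simp add: right_diff_distrib sum_subtractf sum_distrib_right[symmetric])
    ultimately show ?thesis by simp
  qed
  have rhs: "integrable P (\<lambda>\<omega>. \<Sum>n=i..N. c n * (j (us n \<omega>) - j u))"
    using int by (intro Bochner_Integration.integrable_sum integrable_mult_right) auto
  show int_a: "integrable P (\<lambda>\<omega>. j (?a \<omega>) - j u)"
  proof (rule Bochner_Integration.integrable_bound[OF rhs])
    show "(\<lambda>\<omega>. j (?a \<omega>) - j u) \<in> borel_measurable P"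
      using j_borel[OF a_meas aU] by simp
    show "AE \<omega> in P. norm (j (?a \<omega>) - j u) \<le> norm (\<Sum>n=i..N. c n * (j (us n \<omega>) - j u))"
      using jensen u_min[OF aU] by (intro AE_I2) force
  qed
  show "0 \<le> expectation (\<lambda>\<omega>. j (?a \<omega>) - j u)"
    using u_min[OF aU] by (intro integral_nonneg_AE AE_I2) auto
  have "expectation (\<lambda>\<omega>. j (?a \<omega>) - j u) \<le> expectation (\<lambda>\<omega>. \<Sum>n=i..N. c n * (j (us n \<omega>) - j u))"
    using jensen by (rule integral_mono[OF int_a rhs])
  also have "\<dots> = (\<Sum>n=i..N. c n * gap n)"
    using int by (subst Bochner_Integration.integral_sum) auto
  finally have "?T * expectation (\<lambda>\<omega>. j (?a \<omega>) - j u) \<le> ?T * (\<Sum>n=i..N. c n * gap n)"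
    using T by (intro mult_left_mono) auto
  also have "\<dots> = (\<Sum>n=i..N. t n * gap n)"
    using T by (simp add: sum_distrib_left c_def)
  also note weighted_gap_sum[OF i]
  finally show "?T * expectation (\<lambda>\<omega>. j (?a \<omega>) - j u)
      \<le> b\<^sup>2 / 2 + M / 2 * (\<Sum>n=i..N. (t n)\<^sup>2) + b * (\<Sum>n=i..N. t n * K n)" .
qed

end

section \<open>Convergence rates\<close>

context convex_projected_sg
begin

text \<open>With \<open>t = \<tau> / sqrt N\<close> the steps add up to \<open>\<tau> sqrt N\<close> and their squares to \<open>\<tau>\<^sup>2\<close>, and the bias
  contributes \<open>t \<Sum> K\<^sub>n \<le> \<tau> C\<close>.\<close>

lemma constant_step_rate:
  fixes \<tau> C :: real
  assumes N: "1 \<le> N" "N \<in> I" and \<tau>: "0 < \<tau>" and t: "\<And>n. n \<in> {1..N} \<Longrightarrow> t n = \<tau> / sqrt (real N)"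
    and C: "(\<Sum>n=1..N. bias P dj us EG n) \<le> ereal (C * sqrt (real N))"
  shows "expectation (\<lambda>\<omega>. j (averaged_iterate t us 1 N \<omega>) - j u)
    \<le> (b\<^sup>2 / (2 * \<tau>) + M * \<tau> / 2 + b * C) * (1 / sqrt (real N))"
proof -
  let ?X = "expectation (\<lambda>\<omega>. j (averaged_iterate t us 1 N \<omega>) - j u)" and ?s = "sqrt (real N)"
  have s: "0 < ?s" "?s * ?s = real N" using N(1) by auto
  have "(\<Sum>n=1..N. bias P dj us EG n) = (\<Sum>n=1..N. ereal (K n))"
    using initial_segment[OF N(2)] by (intro sum.cong refl bias_finite(1)) auto
  then have K: "(\<Sum>n=1..N. K n) \<le> C * ?s" using C by simp
  have "(\<Sum>n=1..N. t n) = real N * (\<tau> / ?s)" using t by simp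
  also have "\<dots> = \<tau> * ?s" using s by (simp add: field_simps)
  finally have T: "(\<Sum>n=1..N. t n) = \<tau> * ?s" .
  have "(\<Sum>n=1..N. (t n)\<^sup>2) = real N * (\<tau> / ?s)\<^sup>2" using t by simp
  also have "\<dots> = \<tau>\<^sup>2" using N(1) by (simp add: power_divide)
  finally have T2: "(\<Sum>n=1..N. (t n)\<^sup>2) = \<tau>\<^sup>2" .
  have "(\<Sum>n=1..N. t n * K n) = \<tau> / ?s * (\<Sum>n=1..N. K n)"
    using t by (simp add: sum_distrib_left)
  also have "\<dots> \<le> \<tau> / ?s * (C * ?s)" using K \<tau> s by (intro mult_left_mono) auto
  also have "\<dots> = \<tau> * C" using s by simp
  finally have TK: "(\<Sum>n=1..N. t n * K n) \<le> \<tau> * C" .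
  have "\<tau> * ?s * ?X \<le> b\<^sup>2 / 2 + M / 2 * \<tau>\<^sup>2 + b * (\<Sum>n=1..N. t n * K n)"
    using averaged_gap(3)[of 1 N] N unfolding T T2 by simp
  also have "\<dots> \<le> b\<^sup>2 / 2 + M / 2 * \<tau>\<^sup>2 + b * (\<tau> * C)"
    using TK b_nonneg by (intro add_left_mono mult_left_mono)
  also have "\<dots> = \<tau> * (b\<^sup>2 / (2 * \<tau>) + M * \<tau> / 2 + b * C)"
    using \<tau> by (simp add: field_simps power2_eq_square)
  finally have "?s * ?X \<le> b\<^sup>2 / (2 * \<tau>) + M * \<tau> / 2 + b * C"
    using \<tau> by (simp only: mult.assoc mult_le_cancel_left_pos)
  then show ?thesis using s by (simp add: field_simps)
qed

text \<open>Averaging starts at \<open>i = \<lceil>\<alpha> N\<rceil>\<close>. This leaves at least \<open>(1 - \<alpha>) N\<close> steps of length at least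
  \<open>\<tau> / sqrt N\<close>, while the squares \<open>\<tau>\<^sup>2 / n \<le> \<tau>\<^sup>2 / (\<alpha> N)\<close> have a sum that is bounded in \<open>N\<close>; a
  summation from \<open>n = 1\<close> would produce the harmonic sum and an additional logarithm.\<close>

lemma decreasing_step_rate:
  fixes \<tau> \<alpha> C :: real
  defines "i \<equiv> \<lambda>N. nat \<lceil>\<alpha> * real N\<rceil>"
  assumes N: "1 \<le> N" "N \<in> I" and \<tau>: "0 < \<tau>" and \<alpha>: "0 < \<alpha>" "\<alpha> < 1"
    and t: "\<And>n. n \<in> {i N..N} \<Longrightarrow> t n = \<tau> / sqrt (real n)"
    and C: "(\<Sum>n=i N..N. bias P dj us EG n / ereal (sqrt (real n))) \<le> ereal C"
  shows "integrable P (\<lambda>\<omega>. j (averaged_iterate t us (i N) N \<omega>) - j u)"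
    and "expectation (\<lambda>\<omega>. j (averaged_iterate t us (i N) N \<omega>) - j u)
      \<le> (b\<^sup>2 / 2 + M / 2 * (\<tau>\<^sup>2 / \<alpha>) + b * (\<tau> * C)) / ((1 - \<alpha>) * \<tau>) * (1 / sqrt (real N))"
proof -
  let ?X = "expectation (\<lambda>\<omega>. j (averaged_iterate t us (i N) N \<omega>) - j u)" and ?s = "sqrt (real N)"
  have s: "0 < ?s" "?s * ?s = real N" using N(1) by auto
  have \<alpha>N: "0 < \<alpha> * real N" "\<alpha> * real N < real N" using \<alpha> N(1) by auto
  have i_ge: "\<alpha> * real N \<le> real (i N)" unfolding i_def by (rule real_nat_ceiling_ge)
  have i_lt: "real (i N) < \<alpha> * real N + 1"
    unfolding i_def using \<alpha>N(1) ceiling_correct[of "\<alpha> * real N"] by simp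
  have i: "1 \<le> i N" "i N \<le> N"
    using i_ge i_lt \<alpha>N by linarith+
  note gap = averaged_gap[OF i N(2)]
  show "integrable P (\<lambda>\<omega>. j (averaged_iterate t us (i N) N \<omega>) - j u)" by (rule gap(1))
  have I: "n \<in> I" "0 < real n" "real n \<le> real N" "\<alpha> * real N \<le> real n" if "n \<in> {i N..N}" for n
    using initial_segment[OF N(2)] i i_ge that by auto
  have "(\<Sum>n=i N..N. bias P dj us EG n / ereal (sqrt (real n))) = (\<Sum>n=i N..N. ereal (K n / sqrt (real n)))"
  proof (rule sum.cong[OF refl])
    fix n assume n: "n \<in> {i N..N}"
    show "bias P dj us EG n / ereal (sqrt (real n)) = ereal (K n / sqrt (real n))"
      using I(2)[OF n] by (subst bias_finite(1)[OF I(1)[OF n]]) simp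
  qed
  then have K: "(\<Sum>n=i N..N. K n / sqrt (real n)) \<le> C" using C by simp
  have "(1 - \<alpha>) * \<tau> * ?s = (1 - \<alpha>) * real N * (\<tau> / ?s)"
    using s by (simp add: field_simps)
  also have "\<dots> \<le> (real N - real (i N) + 1) * (\<tau> / ?s)"
    using i_lt \<tau> s by (intro mult_right_mono) (auto simp: algebra_simps)
  also have "\<dots> = (\<Sum>n=i N..N. \<tau> / ?s)" using i by (simp add: of_nat_diff)
  also have "\<dots> \<le> (\<Sum>n=i N..N. t n)"
  proof (rule sum_mono)
    fix n assume n: "n \<in> {i N..N}"
    show "\<tau> / ?s \<le> t n"
      unfolding t[OF n] using I[OF n] \<tau> by (intro divide_left_mono) auto
  qed
  finally have T: "(1 - \<alpha>) * \<tau> * ?s \<le> (\<Sum>n=i N..N. t n)" .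
  have "(\<Sum>n=i N..N. (t n)\<^sup>2) \<le> (\<Sum>n=i N..N. \<tau>\<^sup>2 / (\<alpha> * real N))"
  proof (rule sum_mono)
    fix n assume n: "n \<in> {i N..N}"
    have "(t n)\<^sup>2 = \<tau>\<^sup>2 / real n" unfolding t[OF n] by (simp add: power_divide)
    also have "\<dots> \<le> \<tau>\<^sup>2 / (\<alpha> * real N)"
      using I[OF n] \<alpha>N by (intro divide_left_mono) auto
    finally show "(t n)\<^sup>2 \<le> \<tau>\<^sup>2 / (\<alpha> * real N)" .
  qed
  also have "\<dots> \<le> real N * (\<tau>\<^sup>2 / (\<alpha> * real N))"
    using i \<alpha>N unfolding sum_constant by (intro mult_right_mono) auto
  also have "\<dots> = \<tau>\<^sup>2 / \<alpha>" using N(1) by simp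
  finally have T2: "(\<Sum>n=i N..N. (t n)\<^sup>2) \<le> \<tau>\<^sup>2 / \<alpha>" .
  have "(\<Sum>n=i N..N. t n * K n) = \<tau> * (\<Sum>n=i N..N. K n / sqrt (real n))"
    using t by (simp add: sum_distrib_left)
  also have "\<dots> \<le> \<tau> * C" using K \<tau> by (intro mult_left_mono) auto
  finally have TK: "(\<Sum>n=i N..N. t n * K n) \<le> \<tau> * C" .
  have "(1 - \<alpha>) * \<tau> * ?s * ?X \<le> (\<Sum>n=i N..N. t n) * ?X"
    using T gap(2) by (rule mult_right_mono)
  also note gap(3)
  also have "b\<^sup>2 / 2 + M / 2 * (\<Sum>n=i N..N. (t n)\<^sup>2) + b * (\<Sum>n=i N..N. t n * K n)
      \<le> b\<^sup>2 / 2 + M / 2 * (\<tau>\<^sup>2 / \<alpha>) + b * (\<tau> * C)"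
    using T2 TK b_nonneg M_pos by (intro add_mono mult_left_mono order_refl) auto
  finally have "?X * ((1 - \<alpha>) * \<tau> * ?s) \<le> b\<^sup>2 / 2 + M / 2 * (\<tau>\<^sup>2 / \<alpha>) + b * (\<tau> * C)"
    by (simp only: mult.commute)
  then have "?X \<le> (b\<^sup>2 / 2 + M / 2 * (\<tau>\<^sup>2 / \<alpha>) + b * (\<tau> * C)) / ((1 - \<alpha>) * \<tau> * ?s)"
    using \<alpha> \<tau> s by (subst pos_le_divide_eq) auto
  then show "?X \<le> (b\<^sup>2 / 2 + M / 2 * (\<tau>\<^sup>2 / \<alpha>) + b * (\<tau> * C)) / ((1 - \<alpha>) * \<tau>) * (1 / ?s)"
    by simp
qed

end

theorem theorem3p3:
  fixes P :: "'w measure"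
    and Uad V :: "'u::{real_inner, complete_space} set"
    and \<Xi> :: "(real ^ 'm) set"
    and \<xi> :: "'w \<Rightarrow> real ^ 'm"
    and J :: "'u \<Rightarrow> real ^ 'm \<Rightarrow> real"
    and G :: "'u \<Rightarrow> real ^ 'm \<Rightarrow> 'u"
    and M Dad :: real
    and u1 u :: 'u
    and j :: "'u \<Rightarrow> real"
  defines "j \<equiv> expected_objective P \<xi> J"
    and "Dad \<equiv> (SUP v\<in>Uad. norm (u1 - v))"
  assumes "prob_space P"
    and "Uad \<noteq> {}" "closed Uad" "convex Uad" "bounded Uad"
    and "\<xi> \<in> P \<rightarrow>\<^sub>M restrict_space borel \<Xi>"
    and "AE \<omega> in P. convex_on Uad (\<lambda>v. J v (\<xi> \<omega>))"
    and "open V" "Uad \<subseteq> V"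
    and "\<And>v. v \<in> V \<Longrightarrow> integrable P (\<lambda>\<omega>. J v (\<xi> \<omega>))"
    and "\<And>v. v \<in> V \<Longrightarrow> L2_frechet_differentiable_at P (\<lambda>w \<omega>. J w (\<xi> \<omega>)) v"
    and "(\<lambda>(v, x). G v x) \<in> borel \<Otimes>\<^sub>M restrict_space borel \<Xi> \<rightarrow>\<^sub>M borel"
    and "0 < M" "\<And>v. v \<in> Uad \<Longrightarrow> (\<integral>\<^sup>+\<omega>. ennreal ((norm (G v (\<xi> \<omega>)))\<^sup>2) \<partial>P) \<le> ennreal M"
    and "u1 \<in> Uad"
    and "is_arg_min j (\<lambda>v. v \<in> Uad) u"
    and "convex_on Uad j"
  shows
    "(\<forall>t \<zeta> us F EG.
        (\<forall>N\<ge>1.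
           (\<forall>n\<in>{1..N}. t N n = Dad / sqrt (M * real N)) \<and>
           projected_stochastic_gradient P (restrict_space borel \<Xi>) \<xi> Uad G u1 {1..N} (t N) (\<zeta> N) (us N) \<and>
           stochastic_gradient_assumption P (gradient j) G {1..N} (\<zeta> N) (us N) (F N) (EG N)) \<longrightarrow>
        (\<exists>C::real. \<forall>N\<ge>1.
           (\<Sum>n=1..N. bias P (gradient j) (us N) (EG N) n) \<le> ereal (C * sqrt (real N))) \<longrightarrow>
        (\<exists>C::real. \<forall>N\<ge>1.
           integrable P (\<lambda>\<omega>. j (averaged_iterate (t N) (us N) 1 N \<omega>) - j u) \<and>
           (\<integral>\<omega>. j (averaged_iterate (t N) (us N) 1 N \<omega>) - j u \<partial>P) \<le> C * (1 / sqrt (real N))))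
     \<and>
     (\<forall>t \<zeta> us F EG. \<forall>\<theta> \<alpha> :: real.
        0 < \<theta> \<longrightarrow> 0 < \<alpha> \<longrightarrow> \<alpha> < 1 \<longrightarrow>
        (\<forall>n\<ge>1. t n = \<theta> * Dad / sqrt (M * real n)) \<longrightarrow>
        projected_stochastic_gradient P (restrict_space borel \<Xi>) \<xi> Uad G u1 {1..} t \<zeta> us \<longrightarrow>
        stochastic_gradient_assumption P (gradient j) G {1..} \<zeta> us F EG \<longrightarrow>
        (\<exists>C::real. \<forall>N\<ge>1.
           (\<Sum>n=nat \<lceil>\<alpha> * real N\<rceil>..N. bias P (gradient j) us EG n / ereal (sqrt (real n))) \<le> ereal C) \<longrightarrow>
        (\<exists>C::real. \<forall>N\<ge>1.
           integrable P (\<lambda>\<omega>. j (averaged_iterate t us (nat \<lceil>\<alpha> * real N\<rceil>) N \<omega>) - j u) \<and>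
           (\<integral>\<omega>. j (averaged_iterate t us (nat \<lceil>\<alpha> * real N\<rceil>) N \<omega>) - j u \<partial>P)
             \<le> C * (1 / sqrt (real N))))"
proof -
  let ?S = "restrict_space borel \<Xi> :: (real ^ 'm) measure"
  \<comment> \<open>The gradient is defined by a description operator, so its existence comes first.\<close>
  have GD: "GDERIV j v :> gradient j v" if "v \<in> V" for v
  proof -
    have "\<exists>D. GDERIV j v :> D"
      unfolding j_def expected_objective_def[abs_def]
      using expectation_GDERIV[OF \<open>prob_space P\<close> \<open>open V\<close> that, of "\<lambda>w \<omega>. J w (\<xi> \<omega>)"] assms(12) assms(13)[OF that]
      by blast
    then show ?thesis using gradient_eq by metis
  qed
  have j_cont: "continuous_on Uad j"
  proof (rule continuous_at_imp_continuous_on, rule ballI)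
    fix v assume "v \<in> Uad"
    then have "GDERIV j v :> gradient j v" using GD \<open>Uad \<subseteq> V\<close> by blast
    then show "isCont j v" unfolding gderiv_def by (rule has_derivative_continuous)
  qed
  have j_grad: "j v - j w \<le> (v - w) \<bullet> gradient j v" if "v \<in> Uad" "w \<in> Uad" for v w
    using convex_gradient_inequality[OF \<open>convex_on Uad j\<close> that] GD \<open>Uad \<subseteq> V\<close> that by blast
  have u: "u \<in> Uad" "\<And>v. v \<in> Uad \<Longrightarrow> j u \<le> j v"
    using \<open>is_arg_min j (\<lambda>v. v \<in> Uad) u\<close> by (auto simp: is_arg_min_linorder)
  obtain b where b: "\<And>v w. v \<in> Uad \<Longrightarrow> w \<in> Uad \<Longrightarrow> norm (v - w) \<le> b"
    using \<open>bounded Uad\<close> unfolding bounded_two_points dist_norm by blast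
  have instance_of_run: "convex_projected_sg P ?S \<xi> Uad G M u1 I t \<zeta> us (gradient j) F EG j u b"
    if "projected_stochastic_gradient P ?S \<xi> Uad G u1 I t \<zeta> us"
      "stochastic_gradient_assumption P (gradient j) G I \<zeta> us F EG"
      "\<And>n. n \<in> I \<Longrightarrow> {1..n} \<subseteq> I" for I t \<zeta> us F EG
    by (intro convex_projected_sg.intro projected_sg.intro projected_sg_axioms.intro
        convex_projected_sg_axioms.intro) (fact assms that j_cont j_grad u b)+
  have step_pos: "0 < t n" if "projected_stochastic_gradient P ?S \<xi> Uad G u1 I t \<zeta> us" "n \<in> I" for I t \<zeta> us n
    using that unfolding projected_stochastic_gradient_def by blast
  show ?thesis
  proof (intro conjI allI impI)
    fix t :: "nat \<Rightarrow> nat \<Rightarrow> real" and \<zeta> us F EG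
    assume runs: "\<forall>N\<ge>1. (\<forall>n\<in>{1..N}. t N n = Dad / sqrt (M * real N)) \<and>
        projected_stochastic_gradient P ?S \<xi> Uad G u1 {1..N} (t N) (\<zeta> N) (us N) \<and>
        stochastic_gradient_assumption P (gradient j) G {1..N} (\<zeta> N) (us N) (F N) (EG N)"
      and "\<exists>C::real. \<forall>N\<ge>1. (\<Sum>n=1..N. bias P (gradient j) (us N) (EG N) n) \<le> ereal (C * sqrt (real N))"
    then obtain C :: real where C: "\<And>N. 1 \<le> N \<Longrightarrow>
        (\<Sum>n=1..N. bias P (gradient j) (us N) (EG N) n) \<le> ereal (C * sqrt (real N))" by blast
    \<comment> \<open>Positivity of the steps rules out \<open>Dad = 0\<close>, by which the constant divides.\<close>
    define \<tau> where "\<tau> = Dad / sqrt M"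
    have "0 < t 1 1" using runs by (intro step_pos[of "{1..1}" "t 1" "\<zeta> 1" "us 1" 1]) auto
    then have \<tau>: "0 < \<tau>" using runs by (simp add: \<tau>_def)
    show "\<exists>C::real. \<forall>N\<ge>1.
           integrable P (\<lambda>\<omega>. j (averaged_iterate (t N) (us N) 1 N \<omega>) - j u) \<and>
           (\<integral>\<omega>. j (averaged_iterate (t N) (us N) 1 N \<omega>) - j u \<partial>P) \<le> C * (1 / sqrt (real N))"
    proof (intro exI[of _ "b\<^sup>2 / (2 * \<tau>) + M * \<tau> / 2 + b * C"] allI impI)
      fix N :: nat assume N: "1 \<le> N"
      interpret convex_projected_sg P ?S \<xi> Uad G M u1 "{1..N}" "t N" "\<zeta> N" "us N" "gradient j" "F N" "EG N" j u b
        by (rule instance_of_run) (use runs N in auto)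
      have "N \<in> {1..N}" using N by simp
      moreover have "t N n = \<tau> / sqrt (real N)" if "n \<in> {1..N}" for n
        using runs N that by (simp add: \<tau>_def real_sqrt_mult)
      ultimately show "integrable P (\<lambda>\<omega>. j (averaged_iterate (t N) (us N) 1 N \<omega>) - j u) \<and>
           (\<integral>\<omega>. j (averaged_iterate (t N) (us N) 1 N \<omega>) - j u \<partial>P)
             \<le> (b\<^sup>2 / (2 * \<tau>) + M * \<tau> / 2 + b * C) * (1 / sqrt (real N))"
        using averaged_gap(1)[OF order_refl N] constant_step_rate[OF N _ \<tau> _ C[OF N]] by blast
    qed
  next
    fix t :: "nat \<Rightarrow> real" and \<zeta> us F EG and \<theta> \<alpha> :: real
    assume \<theta>: "0 < \<theta>" and \<alpha>: "0 < \<alpha>" "\<alpha> < 1"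
      and t: "\<forall>n\<ge>1. t n = \<theta> * Dad / sqrt (M * real n)"
      and psg: "projected_stochastic_gradient P ?S \<xi> Uad G u1 {1..} t \<zeta> us"
      and sga: "stochastic_gradient_assumption P (gradient j) G {1..} \<zeta> us F EG"
      and "\<exists>C::real. \<forall>N\<ge>1.
           (\<Sum>n=nat \<lceil>\<alpha> * real N\<rceil>..N. bias P (gradient j) us EG n / ereal (sqrt (real n))) \<le> ereal C"
    then obtain C :: real where C: "\<And>N. 1 \<le> N \<Longrightarrow>
        (\<Sum>n=nat \<lceil>\<alpha> * real N\<rceil>..N. bias P (gradient j) us EG n / ereal (sqrt (real n))) \<le> ereal C" by blast
    define \<tau> where "\<tau> = \<theta> * Dad / sqrt M"
    have t_eq: "t n = \<tau> / sqrt (real n)" if "1 \<le> n" for n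
      using t that by (simp add: \<tau>_def real_sqrt_mult)
    have "0 < t 1" by (rule step_pos[OF psg]) simp
    then have \<tau>: "0 < \<tau>" using t_eq[of 1] by simp
    interpret convex_projected_sg P ?S \<xi> Uad G M u1 "{1..}" t \<zeta> us "gradient j" F EG j u b
      by (rule instance_of_run[OF psg sga]) auto
    show "\<exists>C::real. \<forall>N\<ge>1.
           integrable P (\<lambda>\<omega>. j (averaged_iterate t us (nat \<lceil>\<alpha> * real N\<rceil>) N \<omega>) - j u) \<and>
           (\<integral>\<omega>. j (averaged_iterate t us (nat \<lceil>\<alpha> * real N\<rceil>) N \<omega>) - j u \<partial>P)
             \<le> C * (1 / sqrt (real N))"
    proof (intro exI allI impI)
      fix N :: nat assume N: "1 \<le> N"
      have NI: "N \<in> {1..}" using N by simp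
      have "0 < \<alpha> * real N" using \<alpha> N by simp
      then have "1 \<le> nat \<lceil>\<alpha> * real N\<rceil>" by linarith
      note i_pos = this
      have tN: "t n = \<tau> / sqrt (real n)" if "n \<in> {nat \<lceil>\<alpha> * real N\<rceil>..N}" for n
        using order_trans[OF i_pos] that by (intro t_eq) (simp only: atLeastAtMost_iff)
      show "integrable P (\<lambda>\<omega>. j (averaged_iterate t us (nat \<lceil>\<alpha> * real N\<rceil>) N \<omega>) - j u) \<and>
           (\<integral>\<omega>. j (averaged_iterate t us (nat \<lceil>\<alpha> * real N\<rceil>) N \<omega>) - j u \<partial>P)
             \<le> (b\<^sup>2 / 2 + M / 2 * (\<tau>\<^sup>2 / \<alpha>) + b * (\<tau> * C)) / ((1 - \<alpha>) * \<tau>) * (1 / sqrt (real N))"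
        using decreasing_step_rate[OF N NI \<tau> \<alpha> tN C[OF N]] by blast
    qed
  qed
qed

end
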